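(* Let $G$ be a finite group, let $T$ be a Tambara functor on $G$ and let $\mathscr{S}\subseteq T^{\mu}$ be a semi-Mackey subfunctor of its multiplicative part. Then $\mathscr{S}^{-1}T=\{\mathscr{S}(X)^{-1}T(X)\}_{X\in\mathrm{Ob}({}_G\mathrm{set})}$ has a structure of a Tambara functor induced from that on $T$. Moreover, the natural ring homomorphisms $$\ell_{\mathscr{S},X}\colon T(X)\to\mathscr{S}^{-1}T(X),\quad x\mapsto\frac{x}{1}\qquad (X\in\mathrm{Ob}({}_G\mathrm{set}))$$ form a morphism of Tambara functors $\ell_{\mathscr{S}}\colon T\to\mathscr{S}^{-1}T$.
   Context: All monoids and rings are commutative with unit; homomorphisms preserve units. $G$ is a finite group and ${}_G\mathrm{set}$ is the category of finite $G$-sets and $G$-equivariant maps. A semi-Mackey functor $M=(M^{\ast},M_{\ast})$ on $G$ consists of a contravariant functor $M^{\ast}$ and a covariant functor $M_{\ast}$ from ${}_G\mathrm{set}$ to sets with $M^{\ast}(X)=M_{\ast}(X)=:M(X)$, such that $M(X\amalg Y)\to M(X)\times M(Y)$ (restriction along the inclusions) is bijective, and for every pullback square $f\xi=\eta f'$ ($f\colon X\to Y$, $\eta\colon Y'\to Y$, $\xi\colon X'\to X$, $f'\colon X'\to Y'$) one has $M^{\ast}(f)M_{\ast}(\eta)=M_{\ast}(\xi)M^{\ast}(f')$. Each $M(X)$ is then a monoid (operation: $M(X)\times M(X)\cong M(X\amalg X)\to M(X)$ via $M_{\ast}$ of the folding map) and all structure maps are monoid homomorphisms. It is a Mackey functor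 if every $M(X)$ is an abelian group. A semi-Mackey subfunctor is a family of submonoids closed under all $M^{\ast}(f)$ and $M_{\ast}(f)$. A Tambara functor $T=(T^{\ast},T_+,T_{\bullet})$ on $G$ consists of two covariant functors $T_+,T_\bullet$ and one contravariant functor $T^{\ast}$ from ${}_G\mathrm{set}$ to sets such that $T^{\alpha}=(T^{\ast},T_+)$ is a Mackey functor, $T^{\mu}=(T^{\ast},T_{\bullet})$ is a semi-Mackey functor, and for every exponential diagram ($X\xrightarrow{f}Y$, $A\xrightarrow{p}X$, $Z\xrightarrow{\lambda}A$, $Z\xrightarrow{\rho}B$, $B\xrightarrow{q}Y$) the distributive law $T_{\bullet}(f)T_+(p)=T_+(q)T_{\bullet}(\rho)T^{\ast}(\lambda)$ holds. Here an exponential diagram is one isomorphic to: $B=\Pi_f(A)=\{(y,\sigma)\mid y\in Y,\ \sigma\colon f^{-1}(y)\to A,\ p\circ\sigma=\mathrm{id}\}$ with $G$ acting by $g(y,\sigma)=(gy,g\sigma g^{-1})$, $q(y,\sigma)=y$, $Z=X\times_Y B$, $\rho$ the projection, $\lambda(x,(y,\sigma))=\sigma(x)$. Each $T(X)$ is then a ring, with addition from $T^{\alpha}$ and multiplication from $T^{\mu}$. Write $f^{\ast},f_+,f_{\bullet}$ for $T^{\ast}(f),T_+(f),T_{\bullet}(f)$. A morphism of Tambara functors is a family of ring homomorphisms natural for $f^{\ast},f_+,f_{\bullet}$. The induced structure on $\mathscr{S}^{-1}T$ (where $\mathscr{S}(X)^{-1}T(X)$ is the ordinary localization of the ring $T(X)$)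 is, for $f\colon X\to Y$: $f^{\ast}(\frac{y}{t})=\frac{f^{\ast}(y)}{f^{\ast}(t)}$, $f_{\bullet}(\frac{x}{s})=\frac{f_{\bullet}(x)}{f_{\bullet}(s)}$, and $f_+(\frac{x}{s})=\frac{f_+(ax)}{f_{\bullet}(s)}$ where $a\in T(X)$ is any element with $f^{\ast}f_{\bullet}(s)=as$ (such $a$ exists). *)

theory Defs
  imports "HOL-Algebra.Group_Action" "HOL-Algebra.QuotRing"
begin

section \<open>Finite G-sets\<close>

text \<open>Objects are finite G-sets whose points lie in a fixed type \<open>'u\<close>. When \<open>'u\<close> is infinite, every
  finite G-set is isomorphic to one of these, so they form a category equivalent to that of all
  finite G-sets; in particular it has all coproducts, pullbacks and exponential diagrams.\<close>

record ('g, 'u) gset =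
  pts :: "'u set"
  act :: "'g \<Rightarrow> 'u \<Rightarrow> 'u"

definition fin_gset :: "('g, 'm) monoid_scheme \<Rightarrow> ('g, 'u) gset \<Rightarrow> bool" where
  "fin_gset G X \<longleftrightarrow>
     finite (pts X) \<and> group_action G (pts X) (act X) \<and> act X \<in> extensional (carrier G)"

definition gmap ::
    "('g, 'm) monoid_scheme \<Rightarrow> ('g, 'u) gset \<Rightarrow> ('g, 'v) gset \<Rightarrow> ('u \<Rightarrow> 'v) \<Rightarrow> bool" where
  "gmap G X Y f \<longleftrightarrow> fin_gset G X \<and> fin_gset G Y \<and> f \<in> pts X \<rightarrow>\<^sub>E pts Y \<and>
     (\<forall>g\<in>carrier G. \<forall>x\<in>pts X. f (act X g x) = act Y g (f x))"

definition gset_iso ::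
    "('g, 'm) monoid_scheme \<Rightarrow> ('g, 'u) gset \<Rightarrow> ('g, 'v) gset \<Rightarrow> ('u \<Rightarrow> 'v) \<Rightarrow> bool" where
  "gset_iso G X Y f \<longleftrightarrow> gmap G X Y f \<and> bij_betw f (pts X) (pts Y)"

definition coproduct_diagram ::
    "('g, 'm) monoid_scheme \<Rightarrow> ('g, 'u) gset \<Rightarrow> ('g, 'u) gset \<Rightarrow> ('g, 'u) gset \<Rightarrow>
     ('u \<Rightarrow> 'u) \<Rightarrow> ('u \<Rightarrow> 'u) \<Rightarrow> bool" where
  "coproduct_diagram G X Y Z i j \<longleftrightarrow> gmap G X Z i \<and> gmap G Y Z j \<and>
     inj_on i (pts X) \<and> inj_on j (pts Y) \<and>
     i ` pts X \<inter> j ` pts Y = {} \<and> i ` pts X \<union> j ` pts Y = pts Z"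

definition fiber_product_gset ::
    "('g, 'm) monoid_scheme \<Rightarrow> ('g, 'u) gset \<Rightarrow> ('g, 'v) gset \<Rightarrow> ('u \<Rightarrow> 'w) \<Rightarrow> ('v \<Rightarrow> 'w) \<Rightarrow>
     ('g, 'u \<times> 'v) gset" where
  "fiber_product_gset G X Y f h =
     (let P = {(x, y). x \<in> pts X \<and> y \<in> pts Y \<and> f x = h y}
      in \<lparr>pts = P, act = (\<lambda>g\<in>carrier G. \<lambda>(x, y)\<in>P. (act X g x, act Y g y))\<rparr>)"

text \<open>The square \<open>f \<circ> \<xi> = \<eta> \<circ> f'\<close> with \<open>f: X \<rightarrow> Y\<close>, \<open>\<eta>: Y' \<rightarrow> Y\<close>, \<open>\<xi>: X' \<rightarrow> X\<close>,
  \<open>f': X' \<rightarrow> Y'\<close> is a pullback iff \<open>(\<xi>, f')\<close> identifies \<open>X'\<close> with the fiber product.\<close>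

definition pullback_square ::
    "('g, 'm) monoid_scheme \<Rightarrow> ('g, 'u) gset \<Rightarrow> ('g, 'u) gset \<Rightarrow> ('g, 'u) gset \<Rightarrow> ('g, 'u) gset \<Rightarrow>
     ('u \<Rightarrow> 'u) \<Rightarrow> ('u \<Rightarrow> 'u) \<Rightarrow> ('u \<Rightarrow> 'u) \<Rightarrow> ('u \<Rightarrow> 'u) \<Rightarrow> bool" where
  "pullback_square G X Y X' Y' f \<eta> \<xi> f' \<longleftrightarrow>
     gmap G X Y f \<and> gmap G Y' Y \<eta> \<and> gmap G X' X \<xi> \<and> gmap G X' Y' f' \<and>
     gset_iso G X' (fiber_product_gset G X Y' f \<eta>) (\<lambda>x'\<in>pts X'. (\<xi> x', f' x'))"

text \<open>Sections over a fiber are represented as extensional functions.\<close>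

definition Pi_gset ::
    "('g, 'm) monoid_scheme \<Rightarrow> ('g, 'u) gset \<Rightarrow> ('g, 'u) gset \<Rightarrow> ('g, 'u) gset \<Rightarrow>
     ('u \<Rightarrow> 'u) \<Rightarrow> ('u \<Rightarrow> 'u) \<Rightarrow> ('g, 'u \<times> ('u \<Rightarrow> 'u)) gset" where
  "Pi_gset G X Y A f p =
     (let fib = (\<lambda>y. {x\<in>pts X. f x = y});
          P = {(y, \<sigma>). y \<in> pts Y \<and> \<sigma> \<in> fib y \<rightarrow>\<^sub>E pts A \<and> (\<forall>x\<in>fib y. p (\<sigma> x) = x)}
      in \<lparr>pts = P,
          act = (\<lambda>g\<in>carrier G. \<lambda>(y, \<sigma>)\<in>P.
            (act Y g y, \<lambda>x\<in>fib (act Y g y). act A g (\<sigma> (act X (inv\<^bsub>G\<^esub> g) x))))\<rparr>)"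

text \<open>An isomorphism with the standard diagram may be taken to be the identity on \<open>X\<close>, \<open>Y\<close>, \<open>A\<close>,
  because \<open>\<Pi>\<^sub>f(A)\<close> can be transported along isomorphisms of these three objects.\<close>

definition exponential_diagram ::
    "('g, 'm) monoid_scheme \<Rightarrow> ('g, 'u) gset \<Rightarrow> ('g, 'u) gset \<Rightarrow> ('g, 'u) gset \<Rightarrow>
     ('g, 'u) gset \<Rightarrow> ('g, 'u) gset \<Rightarrow>
     ('u \<Rightarrow> 'u) \<Rightarrow> ('u \<Rightarrow> 'u) \<Rightarrow> ('u \<Rightarrow> 'u) \<Rightarrow> ('u \<Rightarrow> 'u) \<Rightarrow> ('u \<Rightarrow> 'u) \<Rightarrow> bool" where
  "exponential_diagram G X Y A Z B f p l r q \<longleftrightarrow>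
     gmap G X Y f \<and> gmap G A X p \<and> gmap G Z A l \<and> gmap G Z B r \<and> gmap G B Y q \<and>
     (\<exists>\<beta> \<zeta>. gset_iso G B (Pi_gset G X Y A f p) \<beta> \<and>
            gset_iso G Z (fiber_product_gset G X (Pi_gset G X Y A f p) f fst) \<zeta> \<and>
            (\<forall>b\<in>pts B. q b = fst (\<beta> b)) \<and>
            (\<forall>z\<in>pts Z. \<beta> (r z) = snd (\<zeta> z) \<and> l z = snd (snd (\<zeta> z)) (fst (\<zeta> z))))"


section \<open>Semi-Mackey and Mackey functors\<close>

text \<open>For \<open>f: X \<rightarrow> Y\<close>, \<open>upper M X Y f\<close> is the contravariant map \<open>M(Y) \<rightarrow> M(X)\<close> and
  \<open>lower M X Y f\<close> the covariant map \<open>M(X) \<rightarrow> M(Y)\<close>.\<close>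

record ('g, 'u, 'a) mackey_data =
  val :: "('g, 'u) gset \<Rightarrow> 'a set"
  upper :: "('g, 'u) gset \<Rightarrow> ('g, 'u) gset \<Rightarrow> ('u \<Rightarrow> 'u) \<Rightarrow> 'a \<Rightarrow> 'a"
  lower :: "('g, 'u) gset \<Rightarrow> ('g, 'u) gset \<Rightarrow> ('u \<Rightarrow> 'u) \<Rightarrow> 'a \<Rightarrow> 'a"

definition contravariant_functor ::
    "('g, 'm) monoid_scheme \<Rightarrow> (('g, 'u) gset \<Rightarrow> 'a set) \<Rightarrow>
     (('g, 'u) gset \<Rightarrow> ('g, 'u) gset \<Rightarrow> ('u \<Rightarrow> 'u) \<Rightarrow> 'a \<Rightarrow> 'a) \<Rightarrow> bool" where
  "contravariant_functor G F \<phi> \<longleftrightarrow>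
     (\<forall>X Y f. gmap G X Y f \<longrightarrow> \<phi> X Y f \<in> F Y \<rightarrow> F X) \<and>
     (\<forall>X. fin_gset G X \<longrightarrow> (\<forall>a\<in>F X. \<phi> X X (\<lambda>x\<in>pts X. x) a = a)) \<and>
     (\<forall>X Y Z f h. gmap G X Y f \<and> gmap G Y Z h \<longrightarrow>
        (\<forall>a\<in>F Z. \<phi> X Z (compose (pts X) h f) a = \<phi> X Y f (\<phi> Y Z h a)))"

definition covariant_functor ::
    "('g, 'm) monoid_scheme \<Rightarrow> (('g, 'u) gset \<Rightarrow> 'a set) \<Rightarrow>
     (('g, 'u) gset \<Rightarrow> ('g, 'u) gset \<Rightarrow> ('u \<Rightarrow> 'u) \<Rightarrow> 'a \<Rightarrow> 'a) \<Rightarrow> bool" where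
  "covariant_functor G F \<phi> \<longleftrightarrow>
     (\<forall>X Y f. gmap G X Y f \<longrightarrow> \<phi> X Y f \<in> F X \<rightarrow> F Y) \<and>
     (\<forall>X. fin_gset G X \<longrightarrow> (\<forall>a\<in>F X. \<phi> X X (\<lambda>x\<in>pts X. x) a = a)) \<and>
     (\<forall>X Y Z f h. gmap G X Y f \<and> gmap G Y Z h \<longrightarrow>
        (\<forall>a\<in>F X. \<phi> X Z (compose (pts X) h f) a = \<phi> Y Z h (\<phi> X Y f a)))"

definition semi_mackey_functor ::
    "('g, 'm) monoid_scheme \<Rightarrow> ('g, 'u, 'a) mackey_data \<Rightarrow> bool" where
  "semi_mackey_functor G M \<longleftrightarrow>
     contravariant_functor G (val M) (upper M) \<and>
     covariant_functor G (val M) (lower M) \<and>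
     (\<forall>X Y Z i j. coproduct_diagram G X Y Z i j \<longrightarrow>
        bij_betw (\<lambda>c. (upper M X Z i c, upper M Y Z j c)) (val M Z) (val M X \<times> val M Y)) \<and>
     (\<forall>X Y X' Y' f \<eta> \<xi> f'. pullback_square G X Y X' Y' f \<eta> \<xi> f' \<longrightarrow>
        (\<forall>c\<in>val M Y'. upper M X Y f (lower M Y' Y \<eta> c) = lower M X' X \<xi> (upper M X' Y' f' c)))"

text \<open>The operation on \<open>M(X)\<close> sends \<open>(a, b)\<close> to \<open>M\<^sub>*(d) c\<close>, where \<open>c \<in> M(X \<amalg> X)\<close> corresponds to
  \<open>(a, b) \<in> M(X) \<times> M(X)\<close> and \<open>d\<close> is the folding map; for a semi-Mackey functor the result does not
  depend on the choice of the coproduct \<open>W\<close>. The unit is the image of the element of \<open>M(\<emptyset>)\<close>.\<close>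

definition mackey_op ::
    "('g, 'm) monoid_scheme \<Rightarrow> ('g, 'u, 'a) mackey_data \<Rightarrow> ('g, 'u) gset \<Rightarrow> 'a \<Rightarrow> 'a \<Rightarrow> 'a" where
  "mackey_op G M X a b = (THE e. \<exists>W i j d c.
     coproduct_diagram G X X W i j \<and>
     gmap G W X d \<and> (\<forall>x\<in>pts X. d (i x) = x \<and> d (j x) = x) \<and>
     c \<in> val M W \<and> upper M X W i c = a \<and> upper M X W j c = b \<and> e = lower M W X d c)"

definition mackey_unit ::
    "('g, 'm) monoid_scheme \<Rightarrow> ('g, 'u, 'a) mackey_data \<Rightarrow> ('g, 'u) gset \<Rightarrow> 'a" where
  "mackey_unit G M X = (THE e. \<exists>E i c.
     pts E = {} \<and> gmap G E X i \<and> c \<in> val M E \<and> e = lower M E X i c)"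

definition mackey_monoid ::
    "('g, 'm) monoid_scheme \<Rightarrow> ('g, 'u, 'a) mackey_data \<Rightarrow> ('g, 'u) gset \<Rightarrow> 'a monoid" where
  "mackey_monoid G M X =
     \<lparr>carrier = val M X, mult = mackey_op G M X, one = mackey_unit G M X\<rparr>"

definition mackey_functor ::
    "('g, 'm) monoid_scheme \<Rightarrow> ('g, 'u, 'a) mackey_data \<Rightarrow> bool" where
  "mackey_functor G M \<longleftrightarrow> semi_mackey_functor G M \<and>
     (\<forall>X. fin_gset G X \<longrightarrow> comm_group (mackey_monoid G M X))"

definition semi_mackey_subfunctor ::
    "('g, 'm) monoid_scheme \<Rightarrow> ('g, 'u, 'a) mackey_data \<Rightarrow> (('g, 'u) gset \<Rightarrow> 'a set) \<Rightarrow> bool" where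
  "semi_mackey_subfunctor G M S \<longleftrightarrow>
     (\<forall>X. fin_gset G X \<longrightarrow> submonoid (S X) (mackey_monoid G M X)) \<and>
     (\<forall>X Y f. gmap G X Y f \<longrightarrow> upper M X Y f ` S Y \<subseteq> S X \<and> lower M X Y f ` S X \<subseteq> S Y)"


section \<open>Tambara functors\<close>

text \<open>For \<open>f: X \<rightarrow> Y\<close>, the maps \<open>f\<^sup>*\<close>, \<open>f\<^sub>+\<close> and \<open>f\<^sub>\<bullet>\<close> are \<open>res T X Y f\<close>, \<open>trf T X Y f\<close> and
  \<open>nrm T X Y f\<close>.\<close>

record ('g, 'u, 'a) tambara_data =
  tval :: "('g, 'u) gset \<Rightarrow> 'a set"
  res :: "('g, 'u) gset \<Rightarrow> ('g, 'u) gset \<Rightarrow> ('u \<Rightarrow> 'u) \<Rightarrow> 'a \<Rightarrow> 'a"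
  trf :: "('g, 'u) gset \<Rightarrow> ('g, 'u) gset \<Rightarrow> ('u \<Rightarrow> 'u) \<Rightarrow> 'a \<Rightarrow> 'a"
  nrm :: "('g, 'u) gset \<Rightarrow> ('g, 'u) gset \<Rightarrow> ('u \<Rightarrow> 'u) \<Rightarrow> 'a \<Rightarrow> 'a"

definition add_part :: "('g, 'u, 'a) tambara_data \<Rightarrow> ('g, 'u, 'a) mackey_data" where
  "add_part T = \<lparr>val = tval T, upper = res T, lower = trf T\<rparr>"

definition mult_part :: "('g, 'u, 'a) tambara_data \<Rightarrow> ('g, 'u, 'a) mackey_data" where
  "mult_part T = \<lparr>val = tval T, upper = res T, lower = nrm T\<rparr>"

definition tambara_functor ::
    "('g, 'm) monoid_scheme \<Rightarrow> ('g, 'u, 'a) tambara_data \<Rightarrow> bool" where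
  "tambara_functor G T \<longleftrightarrow>
     mackey_functor G (add_part T) \<and> semi_mackey_functor G (mult_part T) \<and>
     (\<forall>X Y A Z B f p l r q. exponential_diagram G X Y A Z B f p l r q \<longrightarrow>
        (\<forall>a\<in>tval T A. nrm T X Y f (trf T A X p a) = trf T B Y q (nrm T Z B r (res T Z A l a))))"

definition tambara_ring ::
    "('g, 'm) monoid_scheme \<Rightarrow> ('g, 'u, 'a) tambara_data \<Rightarrow> ('g, 'u) gset \<Rightarrow> 'a ring" where
  "tambara_ring G T X =
     \<lparr>carrier = tval T X,
      mult = mackey_op G (mult_part T) X, one = mackey_unit G (mult_part T) X,
      zero = mackey_unit G (add_part T) X, add = mackey_op G (add_part T) X\<rparr>"

definition tambara_morphism ::
    "('g, 'm) monoid_scheme \<Rightarrow> ('g, 'u, 'a) tambara_data \<Rightarrow> ('g, 'u, 'b) tambara_data \<Rightarrow>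
     (('g, 'u) gset \<Rightarrow> 'a \<Rightarrow> 'b) \<Rightarrow> bool" where
  "tambara_morphism G T T' \<phi> \<longleftrightarrow>
     (\<forall>X. fin_gset G X \<longrightarrow> \<phi> X \<in> ring_hom (tambara_ring G T X) (tambara_ring G T' X)) \<and>
     (\<forall>X Y f. gmap G X Y f \<longrightarrow>
        (\<forall>y\<in>tval T Y. \<phi> X (res T X Y f y) = res T' X Y f (\<phi> Y y)) \<and>
        (\<forall>x\<in>tval T X. \<phi> Y (trf T X Y f x) = trf T' X Y f (\<phi> X x)) \<and>
        (\<forall>x\<in>tval T X. \<phi> Y (nrm T X Y f x) = nrm T' X Y f (\<phi> X x)))"


section \<open>Localization\<close>

definition frac_rel ::
    "('a, 'm) ring_scheme \<Rightarrow> 'a set \<Rightarrow> (('a \<times> 'a) \<times> ('a \<times> 'a)) set" where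
  "frac_rel R S = {((x, s), (y, t)). x \<in> carrier R \<and> s \<in> S \<and> y \<in> carrier R \<and> t \<in> S \<and>
     (\<exists>u\<in>S. u \<otimes>\<^bsub>R\<^esub> (x \<otimes>\<^bsub>R\<^esub> t \<ominus>\<^bsub>R\<^esub> y \<otimes>\<^bsub>R\<^esub> s) = \<zero>\<^bsub>R\<^esub>)}"

definition frac :: "('a, 'm) ring_scheme \<Rightarrow> 'a set \<Rightarrow> 'a \<Rightarrow> 'a \<Rightarrow> ('a \<times> 'a) set" where
  "frac R S x s = frac_rel R S `` {(x, s)}"

text \<open>The operations are those on representatives; on equivalence classes the unions below range
  over copies of one and the same class.\<close>

definition localization :: "('a, 'm) ring_scheme \<Rightarrow> 'a set \<Rightarrow> ('a \<times> 'a) set ring" where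
  "localization R S =
     \<lparr>carrier = (carrier R \<times> S) // frac_rel R S,
      mult = (\<lambda>C D. \<Union>(x, s)\<in>C. \<Union>(y, t)\<in>D. frac R S (x \<otimes>\<^bsub>R\<^esub> y) (s \<otimes>\<^bsub>R\<^esub> t)),
      one = frac R S \<one>\<^bsub>R\<^esub> \<one>\<^bsub>R\<^esub>,
      zero = frac R S \<zero>\<^bsub>R\<^esub> \<one>\<^bsub>R\<^esub>,
      add = (\<lambda>C D. \<Union>(x, s)\<in>C. \<Union>(y, t)\<in>D.
        frac R S (x \<otimes>\<^bsub>R\<^esub> t \<oplus>\<^bsub>R\<^esub> y \<otimes>\<^bsub>R\<^esub> s) (s \<otimes>\<^bsub>R\<^esub> t))\<rparr>"

definition tfrac ::
    "('g, 'm) monoid_scheme \<Rightarrow> ('g, 'u, 'a) tambara_data \<Rightarrow> (('g, 'u) gset \<Rightarrow> 'a set) \<Rightarrow>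
     ('g, 'u) gset \<Rightarrow> 'a \<Rightarrow> 'a \<Rightarrow> ('a \<times> 'a) set" where
  "tfrac G T S X x s = frac (tambara_ring G T X) (S X) x s"

text \<open>\<open>L\<close> has the localized rings as values and the maps induced from those of \<open>T\<close>. The
  equations are imposed for every representative of a fraction, and for the transfer for every
  admissible \<open>a\<close>, so they contain the well-definedness of the induced maps; the existence of an
  admissible \<open>a\<close> is asserted too, so that the condition on the transfer is not vacuous. The last
  condition says that the ring structure which \<open>L\<close> carries as a Tambara functor is the one of the
  localization.\<close>

definition induced_structure ::
    "('g, 'm) monoid_scheme \<Rightarrow> ('g, 'u, 'a) tambara_data \<Rightarrow> (('g, 'u) gset \<Rightarrow> 'a set) \<Rightarrow>
     ('g, 'u, ('a \<times> 'a) set) tambara_data \<Rightarrow> bool" where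
  "induced_structure G T S L \<longleftrightarrow>
     (\<forall>X. fin_gset G X \<longrightarrow> tval L X = carrier (localization (tambara_ring G T X) (S X))) \<and>
     (\<forall>X Y f. gmap G X Y f \<longrightarrow>
        (\<forall>y\<in>tval T Y. \<forall>t\<in>S Y.
           res L X Y f (tfrac G T S Y y t) = tfrac G T S X (res T X Y f y) (res T X Y f t)) \<and>
        (\<forall>x\<in>tval T X. \<forall>s\<in>S X.
           nrm L X Y f (tfrac G T S X x s) = tfrac G T S Y (nrm T X Y f x) (nrm T X Y f s)) \<and>
        (\<forall>s\<in>S X. \<exists>a\<in>tval T X. res T X Y f (nrm T X Y f s) = a \<otimes>\<^bsub>tambara_ring G T X\<^esub> s) \<and>
        (\<forall>x\<in>tval T X. \<forall>s\<in>S X. \<forall>a\<in>tval T X.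
           res T X Y f (nrm T X Y f s) = a \<otimes>\<^bsub>tambara_ring G T X\<^esub> s \<longrightarrow>
           trf L X Y f (tfrac G T S X x s) =
             tfrac G T S Y (trf T X Y f (a \<otimes>\<^bsub>tambara_ring G T X\<^esub> x)) (nrm T X Y f s))) \<and>
     (\<forall>X. fin_gset G X \<longrightarrow>
        id \<in> ring_iso (localization (tambara_ring G T X) (S X)) (tambara_ring G L X))"

end

theory Submission
  imports Defs
begin

text \<open>Restriction and norm are multiplicative and preserve \<open>S\<close>, so they pass to fractions at once. The
  point is the transfer along \<open>f: X \<rightarrow> Y\<close>, which is additive only. Two facts make it work. First, the
  pullback formula for \<open>X \<times>\<^sub>Y X\<close>, with the diagonal split off, shows that \<open>f\<^sup>*f\<^sub>\<bullet>(s)\<close> is a multiple of \<open>s\<close>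
  (\<open>upper_lower_self\<close>); hence every fraction over \<open>X\<close> can be written \<open>x / f\<^sup>*(t)\<close> with a denominator \<open>t\<close>
  over \<open>Y\<close>, and localizing \<open>T(X)\<close> at \<open>S(X)\<close> is the same as localizing it at \<open>f\<^sup>*(S(Y))\<close>. Second, the
  projection formula \<open>f\<^sub>+(f\<^sup>*(y) x) = y f\<^sub>+(x)\<close> (\<open>projection_formula\<close>) says that \<open>f\<^sub>+\<close> is linear over
  \<open>T(Y)\<close>, so that \<open>f\<^sub>+(x / f\<^sup>*(t)) = f\<^sub>+(x) / t\<close> is well defined (\<open>trf_fr_cong\<close>).

  Once fractions are written with restricted denominators, every axiom for the localized functor
  reduces to the same axiom for \<open>T\<close> in the numerator and an identity between restrictions and norms in
  the denominator. Additivity needs that an element over a coproduct lies in \<open>S\<close> if its components do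
  (\<open>S_glue\<close>).

  The structure of a functor is only given by its values on maps of G-sets. That the values of a
  semi-Mackey functor are monoids and its maps homomorphisms comes from one formula for pushing
  forward an element over a coproduct (\<open>lower_coproduct\<close>), and distributivity in the rings of a Tambara
  functor is the projection formula for a folding map (\<open>cring_tambara\<close>). The ring structure on the
  localized functor is computed on suitably chosen elements over \<open>X \<amalg> X\<close> and turns out to be the usual
  one of fractions (\<open>L_add_fr\<close>, \<open>L_mult_fr\<close>).\<close>


section \<open>Constructions with finite G-sets\<close>

lemma fin_gset_finite: "fin_gset G X \<Longrightarrow> finite (pts X)"
  by (simp add: fin_gset_def)

lemma act_closed: "fin_gset G X \<Longrightarrow> g \<in> carrier G \<Longrightarrow> x \<in> pts X \<Longrightarrow> act X g x \<in> pts X"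
  unfolding fin_gset_def using group_action.element_image by fastforce

lemma act_one: "fin_gset G X \<Longrightarrow> x \<in> pts X \<Longrightarrow> act X \<one>\<^bsub>G\<^esub> x = x"
  unfolding fin_gset_def by (metis group_action.id_eq_one restrict_apply')

lemma act_mult:
  "fin_gset G X \<Longrightarrow> g \<in> carrier G \<Longrightarrow> h \<in> carrier G \<Longrightarrow> x \<in> pts X \<Longrightarrow>
    act X (g \<otimes>\<^bsub>G\<^esub> h) x = act X g (act X h x)"
  unfolding fin_gset_def by (metis group_action.composition_rule)

lemma gmapI:
  "fin_gset G X \<Longrightarrow> fin_gset G Y \<Longrightarrow> f \<in> extensional (pts X) \<Longrightarrow>
   (\<And>x. x \<in> pts X \<Longrightarrow> f x \<in> pts Y) \<Longrightarrow>
   (\<And>g x. g \<in> carrier G \<Longrightarrow> x \<in> pts X \<Longrightarrow> f (act X g x) = act Y g (f x)) \<Longrightarrow> gmap G X Y f"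
  unfolding gmap_def PiE_def by blast

lemma
  assumes "gmap G X Y f"
  shows gmap_dom: "fin_gset G X" and gmap_cod: "fin_gset G Y"
    and gmap_ext: "f \<in> extensional (pts X)"
    and gmap_app: "x \<in> pts X \<Longrightarrow> f x \<in> pts Y"
    and gmap_equiv: "g \<in> carrier G \<Longrightarrow> x \<in> pts X \<Longrightarrow> f (act X g x) = act Y g (f x)"
  using assms unfolding gmap_def PiE_def by auto

lemma gmap_eqI:
  "gmap G X Y f \<Longrightarrow> gmap G X Z h \<Longrightarrow> (\<And>x. x \<in> pts X \<Longrightarrow> f x = h x) \<Longrightarrow> f = h"
  by (meson extensionalityI gmap_ext)

lemma gmap_restrict:
  "fin_gset G X \<Longrightarrow> fin_gset G Y \<Longrightarrow> (\<And>x. x \<in> pts X \<Longrightarrow> f x \<in> pts Y) \<Longrightarrow>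
   (\<And>g x. g \<in> carrier G \<Longrightarrow> x \<in> pts X \<Longrightarrow> f (act X g x) = act Y g (f x)) \<Longrightarrow>
   gmap G X Y (\<lambda>x\<in>pts X. f x)"
  by (rule gmapI) (auto simp: act_closed)

lemma gmap_id: "fin_gset G X \<Longrightarrow> gmap G X X (\<lambda>x\<in>pts X. x)"
  by (rule gmap_restrict) simp_all

lemma gmap_compose: "gmap G X Y f \<Longrightarrow> gmap G Y Z h \<Longrightarrow> gmap G X Z (compose (pts X) h f)"
  unfolding compose_def
  by (rule gmap_restrict) (auto simp: gmap_dom gmap_cod gmap_app gmap_equiv)

context group
begin

lemma fin_gsetI:
  assumes fin: "finite (pts X)"
    and cl: "\<And>g x. g \<in> carrier G \<Longrightarrow> x \<in> pts X \<Longrightarrow> act X g x \<in> pts X"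
    and one: "\<And>x. x \<in> pts X \<Longrightarrow> act X \<one> x = x"
    and mult: "\<And>g h x. g \<in> carrier G \<Longrightarrow> h \<in> carrier G \<Longrightarrow> x \<in> pts X \<Longrightarrow>
      act X (g \<otimes> h) x = act X g (act X h x)"
    and ext: "act X \<in> extensional (carrier G)"
      "\<And>g. g \<in> carrier G \<Longrightarrow> act X g \<in> extensional (pts X)"
  shows "fin_gset G X"
proof -
  have inv: "act X (inv g) (act X g x) = x" "act X g (act X (inv g) x) = x"
    if "g \<in> carrier G" "x \<in> pts X" for g x
    using that mult[of "inv g" g x] mult[of g "inv g" x] one by auto
  have bij: "bij_betw (act X g) (pts X) (pts X)" if "g \<in> carrier G" for g
    by (rule bij_betw_byWitness[where f' = "act X (inv g)"]) (use that inv cl in auto)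
  have Bij: "act X g \<in> Bij (pts X)" if "g \<in> carrier G" for g
    unfolding Bij_def using bij ext(2) that by auto
  have "act X (g \<otimes> h) = compose (pts X) (act X g) (act X h)"
    if "g \<in> carrier G" "h \<in> carrier G" for g h
    by (rule extensionalityI[of _ "pts X"]) (use that ext(2) mult in \<open>auto simp: compose_def\<close>)
  then have "act X \<in> hom G (BijGroup (pts X))"
    using Bij by (auto simp: hom_def BijGroup_def)
  then have "group_action G (pts X) (act X)"
    by (simp add: group_action_def group_hom_def group_hom_axioms_def group_BijGroup is_group)
  then show ?thesis using fin ext(1) by (simp add: fin_gset_def)
qed

text \<open>This is how fiber products and sets of sections are recognized as finite G-sets: along a bijection
  from a known one, the axioms come for free.\<close>

lemma gset_iso_transport:
  assumes X: "fin_gset G X" and bij: "bij_betw e (pts X) (pts P)"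
    and e: "e \<in> extensional (pts X)"
    and eq: "\<And>g x. g \<in> carrier G \<Longrightarrow> x \<in> pts X \<Longrightarrow> act P g (e x) = e (act X g x)"
    and ext: "act P \<in> extensional (carrier G)"
      "\<And>g. g \<in> carrier G \<Longrightarrow> act P g \<in> extensional (pts P)"
  shows "gset_iso G X P e"
proof -
  have im: "pts P = e ` pts X" using bij by (simp add: bij_betw_def)
  have "fin_gset G P"
    by (rule fin_gsetI)
      (auto simp: im eq act_closed[OF X] act_one[OF X] act_mult[OF X] fin_gset_finite[OF X]
        ext[unfolded im])
  then have "gmap G X P e" using X e eq by (auto intro!: gmapI simp: im)
  then show ?thesis using bij by (simp add: gset_iso_def)
qed

text \<open>Thanks to this, sums and pairs of points may serve to build coproducts and fiber products, which
  are then moved back to the point type of their ingredients.\<close>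

lemma gset_copy:
  assumes X: "fin_gset G (X :: ('a, 'v) gset)" and inf: "infinite (UNIV :: 'u set)"
  obtains Y :: "('a, 'u) gset" and e where "gset_iso G X Y e"
proof -
  obtain B :: "'u set" where "finite B" "card B = card (pts X)"
    using infinite_arbitrarily_large[OF inf] by blast
  then obtain h where h: "bij_betw h (pts X) B"
    using finite_same_card_bij fin_gset_finite[OF X] by metis
  then have inj: "inj_on h (pts X)" by (simp add: bij_betw_def)
  let ?e = "restrict h (pts X)"
  let ?Y = "\<lparr>pts = B, act = (\<lambda>g\<in>carrier G. \<lambda>y\<in>B. h (act X g (inv_into (pts X) h y)))\<rparr>"
  have "bij_betw ?e (pts X) B" using h by (simp cong: bij_betw_cong)
  then have "gset_iso G X ?Y ?e"
    using h inj by (intro gset_iso_transport[OF X])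
      (auto simp: act_closed[OF X] bij_betw_apply inv_into_f_f)
  then show ?thesis by (rule that)
qed

lemma gset_iso_inv:
  assumes "gset_iso G X Y e"
  shows "gmap G Y X (\<lambda>y\<in>pts Y. inv_into (pts X) e y)"
proof (rule gmap_restrict)
  have e: "gmap G X Y e" and bij: "bij_betw e (pts X) (pts Y)"
    using assms by (auto simp: gset_iso_def)
  show "fin_gset G Y" "fin_gset G X" using e by (auto simp: gmap_dom gmap_cod)
  show "inv_into (pts X) e y \<in> pts X" if "y \<in> pts Y" for y
    using bij that by (metis bij_betw_imp_surj_on inv_into_into)
  fix g y assume g: "g \<in> carrier G" and "y \<in> pts Y"
  then obtain x where x: "x \<in> pts X" "y = e x" using bij by (auto simp: bij_betw_def)
  then have "act Y g y = e (act X g x)" using gmap_equiv[OF e g] by simp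
  then show "inv_into (pts X) e (act Y g y) = act X g (inv_into (pts X) e y)"
    using bij x g act_closed[OF gmap_dom[OF e]] by (simp add: bij_betw_def inv_into_f_f)
qed

lemma empty_gset_exists:
  obtains E :: "('a, 'u) gset" where "fin_gset G E" "pts E = {}"
proof
  let ?E = "\<lparr>pts = {}, act = (\<lambda>g\<in>carrier G. \<lambda>x\<in>{}. undefined)\<rparr> :: ('a, 'u) gset"
  show "fin_gset G ?E" by (rule fin_gsetI) auto
qed simp

lemma gmap_from_empty: "fin_gset G E \<Longrightarrow> fin_gset G X \<Longrightarrow> pts E = {} \<Longrightarrow> gmap G E X (\<lambda>x. undefined)"
  by (rule gmapI) auto

subsection \<open>Coproducts\<close>

lemma coproductD:
  assumes "coproduct_diagram G X Y Z i j"
  shows "gmap G X Z i" "gmap G Y Z j"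
    "x \<in> pts X \<Longrightarrow> x' \<in> pts X \<Longrightarrow> i x = i x' \<longleftrightarrow> x = x'"
    "y \<in> pts Y \<Longrightarrow> y' \<in> pts Y \<Longrightarrow> j y = j y' \<longleftrightarrow> y = y'"
    "x \<in> pts X \<Longrightarrow> y \<in> pts Y \<Longrightarrow> i x \<noteq> j y"
    "x \<in> pts X \<Longrightarrow> y \<in> pts Y \<Longrightarrow> j y \<noteq> i x"
    "fin_gset G X" "fin_gset G Y" "fin_gset G Z"
  using assms unfolding coproduct_diagram_def
  by (auto simp: gmap_dom gmap_cod dest: inj_onD)

lemma coproduct_cases:
  assumes "coproduct_diagram G X Y Z i j" "z \<in> pts Z"
  obtains (left) x where "x \<in> pts X" "z = i x" | (right) y where "y \<in> pts Y" "z = j y"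
  using assms unfolding coproduct_diagram_def by blast

lemma coproductI:
  assumes "gmap G X Z i" "gmap G Y Z j"
    "\<And>x x'. x \<in> pts X \<Longrightarrow> x' \<in> pts X \<Longrightarrow> i x = i x' \<Longrightarrow> x = x'"
    "\<And>y y'. y \<in> pts Y \<Longrightarrow> y' \<in> pts Y \<Longrightarrow> j y = j y' \<Longrightarrow> y = y'"
    "\<And>x y. x \<in> pts X \<Longrightarrow> y \<in> pts Y \<Longrightarrow> i x \<noteq> j y"
    "\<And>z. z \<in> pts Z \<Longrightarrow> (\<exists>x\<in>pts X. z = i x) \<or> (\<exists>y\<in>pts Y. z = j y)"
  shows "coproduct_diagram G X Y Z i j"
proof -
  have "inj_on i (pts X)" "inj_on j (pts Y)" using assms(3,4) by (auto simp: inj_on_def)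
  moreover have "i ` pts X \<inter> j ` pts Y = {}" using assms(5) by auto
  moreover have "i ` pts X \<union> j ` pts Y = pts Z"
    using assms(6) gmap_app[OF assms(1)] gmap_app[OF assms(2)] by blast
  ultimately show ?thesis using assms(1,2) by (simp add: coproduct_diagram_def)
qed

lemma coproduct_swap: "coproduct_diagram G X Y Z i j \<Longrightarrow> coproduct_diagram G Y X Z j i"
  unfolding coproduct_diagram_def by auto

lemma coproduct_empty:
  assumes "fin_gset G X" "fin_gset G E" "pts E = {}"
  shows "coproduct_diagram G X E X (\<lambda>x\<in>pts X. x) (\<lambda>x. undefined)"
  using assms by (intro coproductI gmap_id gmap_from_empty) auto

lemma coproduct_exists:
  assumes X: "fin_gset G (X :: ('a, 'u) gset)" and Y: "fin_gset G (Y :: ('a, 'u) gset)"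
    and inf: "infinite (UNIV :: 'u set)"
  obtains Z :: "('a, 'u) gset" and i j where "coproduct_diagram G X Y Z i j"
proof -
  let ?P = "Inl ` pts X \<union> Inr ` pts Y"
  let ?Q = "\<lparr>pts = ?P, act = (\<lambda>g\<in>carrier G. \<lambda>z\<in>?P.
    case z of Inl x \<Rightarrow> Inl (act X g x) | Inr y \<Rightarrow> Inr (act Y g y))\<rparr>"
  have Q: "fin_gset G ?Q"
    by (rule fin_gsetI)
      (auto simp: act_closed[OF X] act_closed[OF Y] act_one[OF X] act_one[OF Y]
        act_mult[OF X] act_mult[OF Y] fin_gset_finite[OF X] fin_gset_finite[OF Y])
  obtain Z :: "('a, 'u) gset" and e where iso: "gset_iso G ?Q Z e" using gset_copy[OF Q inf] .
  have e: "gmap G ?Q Z e" and bij: "bij_betw e ?P (pts Z)" using iso by (auto simp: gset_iso_def)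
  have inj: "e u = e v \<longleftrightarrow> u = v" if "u \<in> ?P" "v \<in> ?P" for u v
    using bij that by (meson bij_betw_imp_inj_on inj_on_eq_iff)
  have "coproduct_diagram G X Y Z (\<lambda>x\<in>pts X. e (Inl x)) (\<lambda>y\<in>pts Y. e (Inr y))"
  proof (rule coproductI)
    show "gmap G X Z (\<lambda>x\<in>pts X. e (Inl x))"
      using X gmap_cod[OF e] gmap_app[OF e] gmap_equiv[OF e, symmetric]
      by (intro gmap_restrict) (auto)
    show "gmap G Y Z (\<lambda>y\<in>pts Y. e (Inr y))"
      using Y gmap_cod[OF e] gmap_app[OF e] gmap_equiv[OF e, symmetric]
      by (intro gmap_restrict) (auto)
  next
    fix z assume "z \<in> pts Z"
    then have "z \<in> e ` ?P" using bij by (simp add: bij_betw_def)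
    then show "(\<exists>x\<in>pts X. z = (\<lambda>x\<in>pts X. e (Inl x)) x) \<or> (\<exists>y\<in>pts Y. z = (\<lambda>y\<in>pts Y. e (Inr y)) y)"
      by auto
  qed (auto simp: inj)
  then show ?thesis by (rule that)
qed

lemma copair_exists:
  assumes c: "coproduct_diagram G X Y Z i j" and f: "gmap G X V f" and h: "gmap G Y V h"
  obtains k where "gmap G Z V k" "\<And>x. x \<in> pts X \<Longrightarrow> k (i x) = f x"
    "\<And>y. y \<in> pts Y \<Longrightarrow> k (j y) = h y"
proof -
  note cD = coproductD[OF c]
  define k where "k = (\<lambda>z\<in>pts Z. if z \<in> i ` pts X then f (inv_into (pts X) i z)
    else h (inv_into (pts Y) j z))"
  have inj: "inj_on i (pts X)" "inj_on j (pts Y)" using c by (auto simp: coproduct_diagram_def)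
  have ki: "k (i x) = f x" if "x \<in> pts X" for x
    using that gmap_app[OF cD(1)] inj by (simp add: k_def)
  have kj: "k (j y) = h y" if "y \<in> pts Y" for y
    using that gmap_app[OF cD(2)] inj cD(6) by (auto simp: k_def)
  have "gmap G Z V k"
  proof (rule gmapI)
    show "k \<in> extensional (pts Z)" by (simp add: k_def)
    show "k z \<in> pts V" if "z \<in> pts Z" for z
      using c that by (rule coproduct_cases) (auto simp: ki kj gmap_app[OF f] gmap_app[OF h])
    fix g z assume g: "g \<in> carrier G" and z: "z \<in> pts Z"
    show "k (act Z g z) = act V g (k z)"
      using c z
      by (rule coproduct_cases)
        (auto simp: ki kj gmap_equiv[OF f g] gmap_equiv[OF h g] act_closed[OF _ g] cD
          gmap_equiv[OF cD(1) g, symmetric] gmap_equiv[OF cD(2) g, symmetric])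
  qed (use cD gmap_cod[OF f] in auto)
  then show ?thesis using ki kj by (rule that)
qed

text \<open>The image of an injective equivariant map is a union of orbits, so its complement is a
  G-set, too, and splits it off as a direct summand.\<close>

lemma complement_exists:
  assumes i: "gmap G X Z i" and inj: "\<And>x x'. x \<in> pts X \<Longrightarrow> x' \<in> pts X \<Longrightarrow> i x = i x' \<Longrightarrow> x = x'"
  obtains C j where "coproduct_diagram G X C Z i j"
proof -
  note Z = gmap_cod[OF i]
  let ?P = "pts Z - i ` pts X"
  let ?C = "\<lparr>pts = ?P, act = (\<lambda>g\<in>carrier G. \<lambda>z\<in>?P. act Z g z)\<rparr>"
  have cl: "act Z g z \<in> ?P" if g: "g \<in> carrier G" and z: "z \<in> ?P" for g z
  proof -
    have "act Z g z \<notin> i ` pts X"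
    proof
      assume "act Z g z \<in> i ` pts X"
      then obtain x where x: "x \<in> pts X" "act Z g z = i x" by auto
      have "z = act Z (inv g) (act Z g z)"
        using act_mult[OF Z, of "inv g" g z] act_one[OF Z] g z by simp
      also have "\<dots> = i (act X (inv g) x)"
        using x g gmap_equiv[OF i] by simp
      finally show False using z x(1) g act_closed[OF gmap_dom[OF i]] by auto
    qed
    then show ?thesis using act_closed[OF Z] g z by simp
  qed
  have C: "fin_gset G ?C"
    by (rule fin_gsetI)
      (use cl in \<open>auto simp: act_one[OF Z] act_mult[OF Z] fin_gset_finite[OF Z]\<close>)
  have "coproduct_diagram G X ?C Z i (\<lambda>z\<in>?P. z)"
  proof (rule coproductI)
    show "gmap G ?C Z (\<lambda>z\<in>?P. z)"
      using C Z cl by (intro gmapI) auto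
  qed (use i inj in auto)
  then show ?thesis by (rule that)
qed

subsection \<open>Pullback squares\<close>

lemma act_fiber_product_ext:
  "act (fiber_product_gset G X Y f h) \<in> extensional (carrier G)"
  "g \<in> carrier G \<Longrightarrow>
    act (fiber_product_gset G X Y f h) g \<in> extensional (pts (fiber_product_gset G X Y f h))"
  by (auto simp: fiber_product_gset_def Let_def)

lemma pts_fiber_product:
  "pts (fiber_product_gset G X Y f h) = {(x, y). x \<in> pts X \<and> y \<in> pts Y \<and> f x = h y}"
  by (simp add: fiber_product_gset_def Let_def)

lemma act_fiber_product:
  "g \<in> carrier G \<Longrightarrow> x \<in> pts X \<Longrightarrow> y \<in> pts Y \<Longrightarrow> f x = h y \<Longrightarrow>
    act (fiber_product_gset G X Y f h) g (x, y) = (act X g x, act Y g y)"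
  by (simp add: fiber_product_gset_def Let_def)

lemma pullback_squareI:
  assumes f: "gmap G X Y f" and h: "gmap G Y' Y h" and k: "gmap G X' X k" and l: "gmap G X' Y' l"
    and comm: "\<And>z. z \<in> pts X' \<Longrightarrow> f (k z) = h (l z)"
    and ex: "\<And>x y. x \<in> pts X \<Longrightarrow> y \<in> pts Y' \<Longrightarrow> f x = h y \<Longrightarrow>
      \<exists>z\<in>pts X'. k z = x \<and> l z = y"
    and inj: "\<And>z z'. z \<in> pts X' \<Longrightarrow> z' \<in> pts X' \<Longrightarrow> k z = k z' \<Longrightarrow> l z = l z' \<Longrightarrow> z = z'"
  shows "pullback_square G X Y X' Y' f h k l"
proof -
  have "gset_iso G X' (fiber_product_gset G X Y' f h) (\<lambda>z\<in>pts X'. (k z, l z))"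
  proof (rule gset_iso_transport)
    show "fin_gset G X'" using k by (rule gmap_dom)
    show "bij_betw (\<lambda>z\<in>pts X'. (k z, l z)) (pts X') (pts (fiber_product_gset G X Y' f h))"
      unfolding bij_betw_def inj_on_def pts_fiber_product
      using comm ex inj gmap_app[OF k] gmap_app[OF l] by (fastforce simp: image_iff)
    fix g z assume "g \<in> carrier G" "z \<in> pts X'"
    then show "act (fiber_product_gset G X Y' f h) g ((\<lambda>z\<in>pts X'. (k z, l z)) z) =
      (\<lambda>z\<in>pts X'. (k z, l z)) (act X' g z)"
      using comm gmap_app[OF k] gmap_app[OF l] act_closed[OF gmap_dom[OF k]]
      by (simp add: act_fiber_product gmap_equiv[OF k] gmap_equiv[OF l])
  qed (simp_all add: act_fiber_product_ext)
  then show ?thesis using f h k l by (simp add: pullback_square_def)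
qed

lemma pullback_exists:
  assumes f: "gmap G (X :: ('a, 'u) gset) Y f" and h: "gmap G Y' (Y :: ('a, 'u) gset) h"
    and inf: "infinite (UNIV :: 'u set)"
  obtains X' k l where "pullback_square G X Y X' Y' f h k l"
proof -
  note X = gmap_dom[OF f] and Y' = gmap_dom[OF h]
  let ?P = "fiber_product_gset G X Y' f h"
  have cl: "(act X g x, act Y' g y) \<in> pts ?P" if "g \<in> carrier G" "(x, y) \<in> pts ?P" for g x y
    using that gmap_equiv[OF f, of g x] gmap_equiv[OF h, of g y]
    by (auto simp: pts_fiber_product act_closed[OF X] act_closed[OF Y'])
  have "finite (pts ?P)"
    by (rule finite_subset[of _ "pts X \<times> pts Y'"])
      (auto simp: pts_fiber_product fin_gset_finite[OF X] fin_gset_finite[OF Y'])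
  then have P: "fin_gset G ?P"
    using cl by (intro fin_gsetI)
      (auto simp: act_fiber_product act_fiber_product_ext
        act_fiber_product_ext(2)[unfolded pts_fiber_product] act_one[OF X] act_one[OF Y']
        act_mult[OF X] act_mult[OF Y'] pts_fiber_product)
  obtain X' :: "('a, 'u) gset" and e where iso: "gset_iso G ?P X' e" using gset_copy[OF P inf] .
  define d where "d = (\<lambda>z\<in>pts X'. inv_into (pts ?P) e z)"
  have e: "gmap G ?P X' e" and bij: "bij_betw e (pts ?P) (pts X')"
    using iso by (auto simp: gset_iso_def)
  have d: "gmap G X' ?P d" unfolding d_def by (rule gset_iso_inv[OF iso])
  have de: "d (e p) = p" if "p \<in> pts ?P" for p
    using bij that gmap_app[OF e] by (simp add: d_def bij_betw_def)
  have ed: "e (d z) = z" if "z \<in> pts X'" for z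
    using bij that by (simp add: d_def bij_betw_inv_into_right)
  have dP: "fst (d z) \<in> pts X" "snd (d z) \<in> pts Y'" "f (fst (d z)) = h (snd (d z))"
    if "z \<in> pts X'" for z
    using gmap_app[OF d that] by (auto simp: pts_fiber_product)
  have act: "d (act X' g z) = (act X g (fst (d z)), act Y' g (snd (d z)))"
    if "g \<in> carrier G" "z \<in> pts X'" for g z
    using gmap_equiv[OF d that] that(1) dP[OF that(2)]
      act_fiber_product[of g "fst (d z)" X "snd (d z)" Y' f h] by simp
  have "pullback_square G X Y X' Y' f h (\<lambda>z\<in>pts X'. fst (d z)) (\<lambda>z\<in>pts X'. snd (d z))"
  proof (rule pullback_squareI[OF f h])
    show "gmap G X' X (\<lambda>z\<in>pts X'. fst (d z))" "gmap G X' Y' (\<lambda>z\<in>pts X'. snd (d z))"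
      using X Y' gmap_dom[OF d] dP act by (auto intro!: gmap_restrict)
  next
    fix x y assume "x \<in> pts X" "y \<in> pts Y'" "f x = h y"
    then have "(x, y) \<in> pts ?P" by (simp add: pts_fiber_product)
    then show "\<exists>z\<in>pts X'. (\<lambda>z\<in>pts X'. fst (d z)) z = x \<and> (\<lambda>z\<in>pts X'. snd (d z)) z = y"
      using gmap_app[OF e] de by (intro bexI[of _ "e (x, y)"]) auto
  next
    fix z z' assume "z \<in> pts X'" "z' \<in> pts X'"
      "(\<lambda>z\<in>pts X'. fst (d z)) z = (\<lambda>z\<in>pts X'. fst (d z)) z'"
      "(\<lambda>z\<in>pts X'. snd (d z)) z = (\<lambda>z\<in>pts X'. snd (d z)) z'"
    then show "z = z'" using ed by (metis prod_eqI restrict_apply')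
  qed (auto simp: dP)
  then show ?thesis by (rule that)
qed

lemma pullbackD:
  assumes "pullback_square G X Y X' Y' f h k l"
  shows "gmap G X Y f" "gmap G Y' Y h" "gmap G X' X k" "gmap G X' Y' l"
    "z \<in> pts X' \<Longrightarrow> f (k z) = h (l z)"
    "x \<in> pts X \<Longrightarrow> y \<in> pts Y' \<Longrightarrow> f x = h y \<Longrightarrow> \<exists>z\<in>pts X'. k z = x \<and> l z = y"
    "z \<in> pts X' \<Longrightarrow> z' \<in> pts X' \<Longrightarrow> k z = k z' \<Longrightarrow> l z = l z' \<Longrightarrow> z = z'"
proof -
  have bij: "bij_betw (\<lambda>z\<in>pts X'. (k z, l z)) (pts X')
      {(x, y). x \<in> pts X \<and> y \<in> pts Y' \<and> f x = h y}"
    using assms by (simp add: pullback_square_def gset_iso_def pts_fiber_product)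
  show "f (k z) = h (l z)" if "z \<in> pts X'"
    using bij_betw_apply[OF bij that] that by simp
  show "\<exists>z\<in>pts X'. k z = x \<and> l z = y" if "x \<in> pts X" "y \<in> pts Y'" "f x = h y"
  proof -
    have "(x, y) \<in> (\<lambda>z\<in>pts X'. (k z, l z)) ` pts X'"
      using bij that by (simp add: bij_betw_def)
    then show ?thesis by auto
  qed
  show "z = z'" if "z \<in> pts X'" "z' \<in> pts X'" "k z = k z'" "l z = l z'"
    using bij_betw_imp_inj_on[OF bij] that by (auto simp: inj_on_def)
qed (use assms in \<open>auto simp: pullback_square_def\<close>)

lemma pullback_swap:
  assumes "pullback_square G X Y X' Y' f h k l"
  shows "pullback_square G Y' Y X' X h f l k"
  using pullbackD(6)[OF assms] pullbackD(7)[OF assms]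
  by (intro pullback_squareI) (auto simp: pullbackD(1-5)[OF assms], metis)

text \<open>Coproducts are disjoint and universal; the next two squares are the instances that govern
  the monoid operation of a semi-Mackey functor.\<close>

lemma pullback_summand:
  assumes c: "coproduct_diagram G X Y P i j" and c': "coproduct_diagram G X' Y' P' i' j'"
    and f: "gmap G X X' f" and m: "gmap G P P' m"
    and mi: "\<And>x. x \<in> pts X \<Longrightarrow> m (i x) = i' (f x)"
    and mj: "\<And>y. y \<in> pts Y \<Longrightarrow> m (j y) \<in> j' ` pts Y'"
  shows "pullback_square G X' P' X P i' m f i"
proof (rule pullback_squareI)
  fix x p assume x: "x \<in> pts X'" and p: "p \<in> pts P" and eq: "i' x = m p"
  show "\<exists>z\<in>pts X. f z = x \<and> i z = p"
    using c p
  proof (rule coproduct_cases)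
    fix z assume z: "z \<in> pts X" "p = i z"
    then show ?thesis
      using eq mi x coproductD(3)[OF c'] gmap_app[OF f] by auto
  next
    fix y assume "y \<in> pts Y" "p = j y"
    then show ?thesis using eq mj[of y] x coproductD(5)[OF c'] by auto
  qed
qed (use f m mi coproductD[OF c] coproductD[OF c'] in auto)

lemma pullback_fold:
  assumes c: "coproduct_diagram G X X W i j" and c': "coproduct_diagram G Y Y V i' j'"
    and d: "gmap G W X d" "\<And>x. x \<in> pts X \<Longrightarrow> d (i x) = x" "\<And>x. x \<in> pts X \<Longrightarrow> d (j x) = x"
    and e: "gmap G V Y e" "\<And>y. y \<in> pts Y \<Longrightarrow> e (i' y) = y" "\<And>y. y \<in> pts Y \<Longrightarrow> e (j' y) = y"
    and f: "gmap G X Y f" and m: "gmap G W V m"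
    and mi: "\<And>x. x \<in> pts X \<Longrightarrow> m (i x) = i' (f x)"
    and mj: "\<And>x. x \<in> pts X \<Longrightarrow> m (j x) = j' (f x)"
  shows "pullback_square G X Y W V f e d m"
proof (rule pullback_squareI[OF f e(1) d(1) m])
  note cD = coproductD[OF c]
  show "f (d w) = e (m w)" if "w \<in> pts W" for w
    using c that by (rule coproduct_cases) (auto simp: d e mi mj gmap_app[OF f])
  show "\<exists>w\<in>pts W. d w = x \<and> m w = v" if x: "x \<in> pts X" and v: "v \<in> pts V" and eq: "f x = e v" for x v
    using c' v
  proof (rule coproduct_cases)
    fix y assume "y \<in> pts Y" "v = i' y"
    then show ?thesis using x eq gmap_app[OF cD(1)]
      by (intro bexI[of _ "i x"]) (auto simp: d e mi)
  next
    fix y assume "y \<in> pts Y" "v = j' y"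
    then show ?thesis using x eq gmap_app[OF cD(2)]
      by (intro bexI[of _ "j x"]) (auto simp: d e mj)
  qed
  show "w = w'" if "w \<in> pts W" "w' \<in> pts W" "d w = d w'" "m w = m w'" for w w'
    by (rule coproduct_cases[OF c that(1)]; rule coproduct_cases[OF c that(2)])
      (use that(3,4) in \<open>auto simp: d mi mj gmap_app[OF f] coproductD[OF c']\<close>)
qed

subsection \<open>Exponential diagrams\<close>

lemma pts_Pi_gset:
  "pts (Pi_gset G X Y A f p) = {(y, \<sigma>). y \<in> pts Y \<and> \<sigma> \<in> {x\<in>pts X. f x = y} \<rightarrow>\<^sub>E pts A \<and>
    (\<forall>x\<in>pts X. f x = y \<longrightarrow> p (\<sigma> x) = x)}"
  by (auto simp: Pi_gset_def Let_def)

lemma act_Pi_gset: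
  "g \<in> carrier G \<Longrightarrow> (y, \<sigma>) \<in> pts (Pi_gset G X Y A f p) \<Longrightarrow>
    act (Pi_gset G X Y A f p) g (y, \<sigma>) =
      (act Y g y, \<lambda>x\<in>{x\<in>pts X. f x = act Y g y}. act A g (\<sigma> (act X (inv g) x)))"
  by (simp add: Pi_gset_def Let_def)

lemma act_Pi_gset_ext:
  "act (Pi_gset G X Y A f p) \<in> extensional (carrier G)"
  "g \<in> carrier G \<Longrightarrow> act (Pi_gset G X Y A f p) g \<in> extensional (pts (Pi_gset G X Y A f p))"
  by (auto simp: Pi_gset_def Let_def)

text \<open>A point \<open>(x, (y, \<sigma>))\<close> of \<open>Z\<close> is sent to \<open>\<sigma>(x)\<close> by \<open>l\<close>, and \<open>p(\<sigma>(x)) = x\<close> because \<open>\<sigma>\<close> is a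
  section; so \<open>p \<circ> l\<close> is the projection of the fiber product to \<open>X\<close>.\<close>

lemma exponential_pullback:
  assumes "exponential_diagram G X Y A Z B f p l r q"
  shows "pullback_square G X Y Z B f q (compose (pts Z) p l) r"
proof -
  let ?P = "Pi_gset G X Y A f p"
  obtain b z where f: "gmap G X Y f" and p: "gmap G A X p" and l: "gmap G Z A l"
    and r: "gmap G Z B r" and q: "gmap G B Y q"
    and b: "bij_betw b (pts B) (pts ?P)"
    and z: "bij_betw z (pts Z) (pts (fiber_product_gset G X ?P f fst))"
    and qb: "\<And>c. c \<in> pts B \<Longrightarrow> q c = fst (b c)"
    and br: "\<And>w. w \<in> pts Z \<Longrightarrow> b (r w) = snd (z w)"
    and lz: "\<And>w. w \<in> pts Z \<Longrightarrow> l w = snd (snd (z w)) (fst (z w))"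
    using assms unfolding exponential_diagram_def gset_iso_def by blast
  have zw: "fst (z w) \<in> pts X" "snd (z w) \<in> pts ?P" "f (fst (z w)) = fst (snd (z w))"
    if "w \<in> pts Z" for w
    using bij_betw_apply[OF z that] by (auto simp: pts_fiber_product)
  have pl: "p (l w) = fst (z w)" if "w \<in> pts Z" for w
    using zw[OF that] lz[OF that] by (auto simp: pts_Pi_gset)
  have qr: "q (r w) = f (fst (z w))" if "w \<in> pts Z" for w
    using that zw br qb gmap_app[OF r] by simp
  show ?thesis
  proof (rule pullback_squareI[OF f q gmap_compose[OF l p] r])
    fix x c assume x: "x \<in> pts X" and c: "c \<in> pts B" and eq: "f x = q c"
    then have "(x, b c) \<in> pts (fiber_product_gset G X ?P f fst)"
      using qb bij_betw_apply[OF b c] by (simp add: pts_fiber_product)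
    then obtain w where w: "w \<in> pts Z" "z w = (x, b c)"
      using z unfolding bij_betw_def by (metis imageE)
    then have "r w = c"
      using br[OF w(1)] gmap_app[OF r w(1)] c b by (auto simp: bij_betw_def inj_on_def)
    then show "\<exists>w\<in>pts Z. compose (pts Z) p l w = x \<and> r w = c"
      using w pl by (intro bexI[of _ w]) (simp_all add: compose_eq)
  next
    fix w w' assume w: "w \<in> pts Z" "w' \<in> pts Z"
      and eq: "compose (pts Z) p l w = compose (pts Z) p l w'" "r w = r w'"
    have "z w = z w'"
      using w eq pl br by (simp add: compose_eq) (metis prod_eqI)
    then show "w = w'" using z w by (auto simp: bij_betw_def inj_on_def)
  qed (simp add: compose_eq pl qr)
qed

text \<open>The exponential diagram behind the projection formula. The fiber of the folding map over \<open>y\<close> has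
  two points; a section of \<open>id \<amalg> f: Y \<amalg> X \<rightarrow> Y \<amalg> Y\<close> has no choice at the first one, and at the second
  one it picks a point of \<open>X\<close> over \<open>y\<close>.\<close>

lemma exponential_fold:
  assumes f: "gmap G X Y f"
    and V: "coproduct_diagram G Y Y V i j" and d: "gmap G V Y d"
      "\<And>y. y \<in> pts Y \<Longrightarrow> d (i y) = y" "\<And>y. y \<in> pts Y \<Longrightarrow> d (j y) = y"
    and A: "coproduct_diagram G Y X A k l" and p: "gmap G A V p"
      "\<And>y. y \<in> pts Y \<Longrightarrow> p (k y) = i y" "\<And>x. x \<in> pts X \<Longrightarrow> p (l x) = j (f x)"
    and W: "coproduct_diagram G X X W m n" and e: "gmap G W X e"
      "\<And>x. x \<in> pts X \<Longrightarrow> e (m x) = x" "\<And>x. x \<in> pts X \<Longrightarrow> e (n x) = x"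
    and r: "gmap G W A r" "\<And>x. x \<in> pts X \<Longrightarrow> r (m x) = k (f x)"
      "\<And>x. x \<in> pts X \<Longrightarrow> r (n x) = l x"
  shows "exponential_diagram G V Y A W X d p r e f"
proof -
  note VD = coproductD[OF V] and AD = coproductD[OF A] and WD = coproductD[OF W]
  note X = gmap_dom[OF f] and Y = gmap_cod[OF f]
  let ?P = "Pi_gset G V Y A d p"
  define \<sigma> where "\<sigma> x = (\<lambda>v\<in>{v\<in>pts V. d v = f x}. if v = i (f x) then k (f x) else l x)" for x
  define b where "b = (\<lambda>x\<in>pts X. (f x, \<sigma> x))"
  define z where "z = (\<lambda>w\<in>pts W. (p (r w), b (e w)))"
  have fX: "f x \<in> pts Y" if "x \<in> pts X" for x using gmap_app[OF f that] .
  have iV: "i y \<in> pts V" "j y \<in> pts V" if "y \<in> pts Y" for y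
    using gmap_app[OF VD(1) that] gmap_app[OF VD(2) that] by auto
  have kA: "k y \<in> pts A" if "y \<in> pts Y" for y using gmap_app[OF AD(1) that] .
  have lA: "l x \<in> pts A" if "x \<in> pts X" for x using gmap_app[OF AD(2) that] .
  have fiber: "v = i y \<or> v = j y" if "v \<in> pts V" "d v = y" for v y
    using V that(1) by (rule coproduct_cases) (use that(2) d in auto)
  have \<sigma>_i: "\<sigma> x (i (f x)) = k (f x)" and \<sigma>_j: "\<sigma> x (j (f x)) = l x" if "x \<in> pts X" for x
    using that fX iV d VD(6) by (auto simp: \<sigma>_def)
  have b_mem: "b x \<in> pts ?P" if x: "x \<in> pts X" for x
  proof -
    have "\<sigma> x v \<in> pts A \<and> p (\<sigma> x v) = v" if v: "v \<in> pts V" "d v = f x" for v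
      using fiber[OF v] \<sigma>_i[OF x] \<sigma>_j[OF x] kA lA p x fX by auto
    then show ?thesis using x fX by (auto simp: b_def pts_Pi_gset \<sigma>_def)
  qed
  have b_inj: "x = x'" if "x \<in> pts X" "x' \<in> pts X" "b x = b x'" for x x'
  proof -
    have "f x = f x'" "\<sigma> x = \<sigma> x'" using that by (simp_all add: b_def)
    then have "l x = l x'" using \<sigma>_j[OF that(1)] \<sigma>_j[OF that(2)] by metis
    then show ?thesis using AD(4) that by blast
  qed
  have b_surj: "\<exists>x\<in>pts X. b x = c" if c: "c \<in> pts ?P" for c
  proof -
    obtain y \<tau> where c_eq: "c = (y, \<tau>)" by (cases c)
    then have y: "y \<in> pts Y" and \<tau>: "\<tau> \<in> {v\<in>pts V. d v = y} \<rightarrow>\<^sub>E pts A"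
      and sec: "\<And>v. v \<in> pts V \<Longrightarrow> d v = y \<Longrightarrow> p (\<tau> v) = v"
      using c by (auto simp: pts_Pi_gset)
    have "\<tau> (i y) \<in> pts A" "\<tau> (j y) \<in> pts A" using \<tau> y iV d by auto
    then have i: "\<tau> (i y) = k y" and j: "\<exists>x\<in>pts X. f x = y \<and> \<tau> (j y) = l x"
      using sec[of "i y"] sec[of "j y"] y iV d p VD fX
      by (auto elim!: coproduct_cases[OF A])
    from j obtain x where x: "x \<in> pts X" "f x = y" "\<tau> (j y) = l x" by blast
    have "\<sigma> x = \<tau>"
    proof (rule extensionalityI[of _ "{v\<in>pts V. d v = y}"])
      show "\<sigma> x v = \<tau> v" if "v \<in> {v\<in>pts V. d v = y}" for v
        using fiber[of v y] that i x \<sigma>_i[OF x(1)] \<sigma>_j[OF x(1)] by auto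
    qed (use \<tau> x in \<open>auto simp: \<sigma>_def PiE_def\<close>)
    then show ?thesis using x c_eq by (auto simp: b_def)
  qed
  have b_equiv: "act ?P g (b x) = b (act X g x)" if g: "g \<in> carrier G" and x: "x \<in> pts X" for g x
  proof -
    have gx: "act X g x \<in> pts X" "f (act X g x) = act Y g (f x)"
      using act_closed[OF X g x] gmap_equiv[OF f g x] .
    have inv_act: "act V (inv g) (act V g v) = v" if "v \<in> pts V" for v
      using act_mult[of G V "inv g" g v] act_one[of G V v] g that VD(9) by simp
    have "act A g (\<sigma> x (act V (inv g) v)) = \<sigma> (act X g x) v"
      if "v \<in> pts V" "d v = act Y g (f x)" for v
      using fiber[OF that]
    proof
      assume "v = i (act Y g (f x))"
      then have "v = act V g (i (f x))" using gmap_equiv[OF VD(1) g] fX[OF x] by simp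
      then show ?thesis
        using inv_act[of "i (f x)"] iV fX[OF x] \<sigma>_i[OF x] \<sigma>_i[OF gx(1)] gx(2)
          gmap_equiv[OF AD(1) g] gmap_equiv[OF VD(1) g] by simp
    next
      assume "v = j (act Y g (f x))"
      then have "v = act V g (j (f x))" using gmap_equiv[OF VD(2) g] fX[OF x] by simp
      then show ?thesis
        using inv_act[of "j (f x)"] iV fX[OF x] \<sigma>_j[OF x] \<sigma>_j[OF gx(1)] gx(2)
          gmap_equiv[OF AD(2) g x] gmap_equiv[OF VD(2) g] by simp
    qed
    then have "(\<lambda>v\<in>{v\<in>pts V. d v = act Y g (f x)}. act A g (\<sigma> x (act V (inv g) v))) = \<sigma> (act X g x)"
      by (auto simp: \<sigma>_def gx(2))
    then show ?thesis
      using act_Pi_gset[OF g, of "f x" "\<sigma> x"] b_mem[OF x] x gx by (simp add: b_def)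
  qed
  have b: "gset_iso G X ?P b"
  proof (rule gset_iso_transport[OF X])
    show "bij_betw b (pts X) (pts ?P)"
      unfolding bij_betw_def inj_on_def using b_mem b_inj b_surj by blast
  qed (auto simp: b_equiv act_Pi_gset_ext, simp add: b_def)
  have eX: "e w \<in> pts X" if "w \<in> pts W" for w using gmap_app[OF e(1) that] .
  have prV: "p (r w) \<in> pts V" if "w \<in> pts W" for w
    using gmap_app[OF p(1)] gmap_app[OF r(1)] that by blast
  have dpr: "d (p (r w)) = f (e w)" if "w \<in> pts W" for w
    using W that by (rule coproduct_cases) (auto simp: r p d e fX)
  have fst_b: "fst (b x) = f x" if "x \<in> pts X" for x using that by (simp add: b_def)
  have z: "gset_iso G W (fiber_product_gset G V ?P d fst) z"
  proof (rule gset_iso_transport)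
    show "fin_gset G W" by (rule WD)
    have "z w \<in> pts (fiber_product_gset G V ?P d fst)" if "w \<in> pts W" for w
      using that by (simp add: z_def pts_fiber_product b_mem eX prV dpr fst_b)
    moreover have "w = w'" if w: "w \<in> pts W" "w' \<in> pts W" "z w = z w'" for w w'
    proof -
      have eq: "e w = e w'" "p (r w) = p (r w')" using w b_inj eX by (auto simp: z_def)
      show ?thesis
        by (rule coproduct_cases[OF W w(1)]; rule coproduct_cases[OF W w(2)])
          (use eq in \<open>auto simp: e r p VD fX\<close>)
    qed
    moreover have "\<exists>w\<in>pts W. z w = c" if c: "c \<in> pts (fiber_product_gset G V ?P d fst)" for c
    proof -
      obtain v c' where c_eq: "c = (v, c')" by (cases c)
      then have v: "v \<in> pts V" "c' \<in> pts ?P" "d v = fst c'"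
        using c by (auto simp: pts_fiber_product)
      then obtain x where x: "x \<in> pts X" "c' = b x" using b_surj by blast
      then have "v = i (f x) \<or> v = j (f x)" using fiber[OF v(1)] v(3) fst_b by simp
      then show ?thesis
      proof
        assume "v = i (f x)"
        then show ?thesis using x c_eq gmap_app[OF WD(1) x(1)]
          by (intro bexI[of _ "m x"]) (auto simp: z_def e r p fX)
      next
        assume "v = j (f x)"
        then show ?thesis using x c_eq gmap_app[OF WD(2) x(1)]
          by (intro bexI[of _ "n x"]) (auto simp: z_def e r p fX)
      qed
    qed
    ultimately show "bij_betw z (pts W) (pts (fiber_product_gset G V ?P d fst))"
      unfolding bij_betw_def inj_on_def by blast
    fix g w assume g: "g \<in> carrier G" and w: "w \<in> pts W"
    show "act (fiber_product_gset G V ?P d fst) g (z w) = z (act W g w)"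
      using w g act_closed[OF WD(9) g w]
      by (simp add: z_def act_fiber_product b_mem eX prV dpr fst_b b_equiv gmap_equiv[OF e(1)]
          gmap_equiv[OF r(1)] gmap_equiv[OF p(1)] gmap_app[OF r(1)])
  qed (auto simp: z_def act_fiber_product_ext)
  have "r w = snd (snd (z w)) (fst (z w))" if w: "w \<in> pts W" for w
    using W w
    by (rule coproduct_cases) (use w in \<open>auto simp: z_def b_def e r p fX \<sigma>_i \<sigma>_j\<close>)
  moreover have "b (e w) = snd (z w)" if "w \<in> pts W" for w using that by (simp add: z_def)
  ultimately show ?thesis
    unfolding exponential_diagram_def using f d(1) p(1) e(1) r(1) b z fst_b
    by (intro conjI exI[of _ b] exI[of _ z]) auto
qed

end

section \<open>The monoids of a semi-Mackey functor\<close>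

locale semi_mackey = group G for G :: "('g, 'm) monoid_scheme" (structure) +
  fixes M :: "('g, 'u, 'a) mackey_data"
  assumes infinite_points: "infinite (UNIV :: 'u set)"
    and semi_mackey: "semi_mackey_functor G M"
    and nonempty: "fin_gset G X \<Longrightarrow> val M X \<noteq> {}"
begin

lemma upper_closed: "gmap G X Y f \<Longrightarrow> c \<in> val M Y \<Longrightarrow> upper M X Y f c \<in> val M X"
proof -
  assume "gmap G X Y f" and c: "c \<in> val M Y"
  then have "upper M X Y f \<in> val M Y \<rightarrow> val M X"
    using semi_mackey unfolding semi_mackey_functor_def contravariant_functor_def by simp
  then show ?thesis using c by (rule funcset_mem)
qed

lemma lower_closed: "gmap G X Y f \<Longrightarrow> c \<in> val M X \<Longrightarrow> lower M X Y f c \<in> val M Y"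
proof -
  assume "gmap G X Y f" and c: "c \<in> val M X"
  then have "lower M X Y f \<in> val M X \<rightarrow> val M Y"
    using semi_mackey unfolding semi_mackey_functor_def covariant_functor_def by simp
  then show ?thesis using c by (rule funcset_mem)
qed

lemma upper_id:
  assumes k: "gmap G X X k" "\<And>x. x \<in> pts X \<Longrightarrow> k x = x" and c: "c \<in> val M X"
  shows "upper M X X k c = c"
proof -
  have X: "fin_gset G X" using k(1) by (rule gmap_dom)
  have "k = (\<lambda>x\<in>pts X. x)" by (rule gmap_eqI[OF k(1) gmap_id[OF X]]) (simp add: k)
  moreover have "\<forall>a\<in>val M X. upper M X X (\<lambda>x\<in>pts X. x) a = a"
    using semi_mackey X unfolding semi_mackey_functor_def contravariant_functor_def by blast
  ultimately show ?thesis using c by simp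
qed

lemma lower_id:
  assumes k: "gmap G X X k" "\<And>x. x \<in> pts X \<Longrightarrow> k x = x" and c: "c \<in> val M X"
  shows "lower M X X k c = c"
proof -
  have X: "fin_gset G X" using k(1) by (rule gmap_dom)
  have "k = (\<lambda>x\<in>pts X. x)" by (rule gmap_eqI[OF k(1) gmap_id[OF X]]) (simp add: k)
  moreover have "\<forall>a\<in>val M X. lower M X X (\<lambda>x\<in>pts X. x) a = a"
    using semi_mackey X unfolding semi_mackey_functor_def covariant_functor_def by blast
  ultimately show ?thesis using c by simp
qed

lemma upper_comp:
  assumes f: "gmap G X Y f" and h: "gmap G Y Z h" and k: "gmap G X Z k"
    and eq: "\<And>x. x \<in> pts X \<Longrightarrow> k x = h (f x)" and c: "c \<in> val M Z"
  shows "upper M X Z k c = upper M X Y f (upper M Y Z h c)"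
proof -
  have "k = compose (pts X) h f"
    by (rule gmap_eqI[OF k gmap_compose[OF f h]]) (simp add: eq compose_eq)
  moreover have "\<forall>a\<in>val M Z. upper M X Z (compose (pts X) h f) a = upper M X Y f (upper M Y Z h a)"
    using semi_mackey f h unfolding semi_mackey_functor_def contravariant_functor_def by simp
  ultimately show ?thesis using c by simp
qed

lemma lower_comp:
  assumes f: "gmap G X Y f" and h: "gmap G Y Z h" and k: "gmap G X Z k"
    and eq: "\<And>x. x \<in> pts X \<Longrightarrow> k x = h (f x)" and c: "c \<in> val M X"
  shows "lower M X Z k c = lower M Y Z h (lower M X Y f c)"
proof -
  have "k = compose (pts X) h f"
    by (rule gmap_eqI[OF k gmap_compose[OF f h]]) (simp add: eq compose_eq)
  moreover have "\<forall>a\<in>val M X. lower M X Z (compose (pts X) h f) a = lower M Y Z h (lower M X Y f a)"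
    using semi_mackey f h unfolding semi_mackey_functor_def covariant_functor_def by simp
  ultimately show ?thesis using c by simp
qed

lemma upper_lower:
  "pullback_square G X Y X' Y' f h k l \<Longrightarrow> c \<in> val M Y' \<Longrightarrow>
    upper M X Y f (lower M Y' Y h c) = lower M X' X k (upper M X' Y' l c)"
  using semi_mackey unfolding semi_mackey_functor_def by blast

lemma coproduct_bij:
  "coproduct_diagram G X Y Z i j \<Longrightarrow>
    bij_betw (\<lambda>c. (upper M X Z i c, upper M Y Z j c)) (val M Z) (val M X \<times> val M Y)"
  using semi_mackey unfolding semi_mackey_functor_def by blast

lemma coproduct_eqI:
  assumes "coproduct_diagram G X Y Z i j" "c \<in> val M Z" "c' \<in> val M Z"
    "upper M X Z i c = upper M X Z i c'" "upper M Y Z j c = upper M Y Z j c'"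
  shows "c = c'"
  using bij_betw_imp_inj_on[OF coproduct_bij[OF assms(1)]] assms(2-) by (auto simp: inj_on_def)

lemma glue_exists:
  assumes "coproduct_diagram G X Y Z i j" "a \<in> val M X" "b \<in> val M Y"
  obtains c where "c \<in> val M Z" "upper M X Z i c = a" "upper M Y Z j c = b"
proof -
  have "(a, b) \<in> (\<lambda>c. (upper M X Z i c, upper M Y Z j c)) ` val M Z"
    using coproduct_bij[OF assms(1)] assms(2,3) by (auto simp: bij_betw_def)
  then show ?thesis using that by auto
qed

lemma val_empty_unique:
  assumes E: "fin_gset G E" "pts E = {}" and c: "c \<in> val M E" "c' \<in> val M E"
  shows "c = c'"
proof -
  note cop = coproduct_empty[OF E(1) E]
  obtain b where b: "b \<in> val M E" "upper M E E (\<lambda>x\<in>pts E. x) b = c"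
    "upper M E E (\<lambda>x. undefined) b = c'"
    using glue_exists[OF cop c] by blast
  have "(\<lambda>x\<in>pts E. x) = (\<lambda>x. undefined)" using E(2) by auto
  then show ?thesis using b by metis
qed

lemma fold_exists:
  fixes X :: "('g, 'u) gset"
  assumes "fin_gset G X"
  obtains W i j d where "coproduct_diagram G X X W i j" "gmap G W X d"
    "\<And>x. x \<in> pts X \<Longrightarrow> d (i x) = x" "\<And>x. x \<in> pts X \<Longrightarrow> d (j x) = x"
proof -
  obtain W i j where c: "coproduct_diagram G X X W i j"
    using coproduct_exists[OF assms assms infinite_points] .
  obtain d where "gmap G W X d" "\<And>x. x \<in> pts X \<Longrightarrow> d (i x) = (\<lambda>x\<in>pts X. x) x"
    "\<And>x. x \<in> pts X \<Longrightarrow> d (j x) = (\<lambda>x\<in>pts X. x) x"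
    using copair_exists[OF c gmap_id[OF assms] gmap_id[OF assms]] by blast
  then show ?thesis using that[OF c] by simp
qed

text \<open>Two choices of \<open>X \<amalg> X\<close> are compared by the canonical map between them.\<close>

lemma mackey_op_eq:
  assumes c: "coproduct_diagram G X X W i j" and d: "gmap G W X d"
    "\<And>x. x \<in> pts X \<Longrightarrow> d (i x) = x" "\<And>x. x \<in> pts X \<Longrightarrow> d (j x) = x"
    and w: "w \<in> val M W"
  shows "mackey_op G M X (upper M X W i w) (upper M X W j w) = lower M W X d w"
  unfolding mackey_op_def
proof (rule the_equality)
  show "\<exists>W' i' j' d' w'. coproduct_diagram G X X W' i' j' \<and> gmap G W' X d' \<and>
      (\<forall>x\<in>pts X. d' (i' x) = x \<and> d' (j' x) = x) \<and> w' \<in> val M W' \<and>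
      upper M X W' i' w' = upper M X W i w \<and> upper M X W' j' w' = upper M X W j w \<and>
      lower M W X d w = lower M W' X d' w'"
    by (rule exI[of _ W], rule exI[of _ i], rule exI[of _ j], rule exI[of _ d], rule exI[of _ w])
      (simp add: c d w)
next
  fix e assume "\<exists>W' i' j' d' w'. coproduct_diagram G X X W' i' j' \<and> gmap G W' X d' \<and>
      (\<forall>x\<in>pts X. d' (i' x) = x \<and> d' (j' x) = x) \<and> w' \<in> val M W' \<and>
      upper M X W' i' w' = upper M X W i w \<and> upper M X W' j' w' = upper M X W j w \<and>
      e = lower M W' X d' w'"
  then obtain W' i' j' d' w' where c': "coproduct_diagram G X X W' i' j'" and d': "gmap G W' X d'"
      "\<forall>x\<in>pts X. d' (i' x) = x \<and> d' (j' x) = x" and w': "w' \<in> val M W'"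
      "upper M X W' i' w' = upper M X W i w" "upper M X W' j' w' = upper M X W j w"
      "e = lower M W' X d' w'"
    by blast
  note cD = coproductD[OF c] and cD' = coproductD[OF c']
  note id = gmap_id[OF cD(7)]
  obtain m where m: "gmap G W W' m" "\<And>x. x \<in> pts X \<Longrightarrow> m (i x) = i' x"
    "\<And>x. x \<in> pts X \<Longrightarrow> m (j x) = j' x"
    using copair_exists[OF c cD'(1,2)] by blast
  have "upper M X W' i' (lower M W W' m w) = lower M X X (\<lambda>x\<in>pts X. x) (upper M X W i w)"
    by (rule upper_lower[OF pullback_summand[OF c c' id m(1)] w]) (auto simp: m)
  moreover have
    "upper M X W' j' (lower M W W' m w) = lower M X X (\<lambda>x\<in>pts X. x) (upper M X W j w)"
    by (rule upper_lower[OF pullback_summand[OF coproduct_swap[OF c] coproduct_swap[OF c'] id m(1)] w])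
      (auto simp: m)
  ultimately have "lower M W W' m w = w'"
    using w w' upper_closed[OF cD(1)] upper_closed[OF cD(2)]
    by (intro coproduct_eqI[OF c' lower_closed[OF m(1) w] w'(1)]) (simp_all add: lower_id[OF id])
  moreover have "lower M W X d w = lower M W' X d' (lower M W W' m w)"
  proof (rule lower_comp[OF m(1) d'(1) d(1) _ w])
    show "d x = d' (m x)" if "x \<in> pts W" for x
      using c that by (rule coproduct_cases) (auto simp: d d' m)
  qed
  ultimately show "e = lower M W X d w" using w' by simp
qed

lemma mackey_unit_eq:
  assumes E: "fin_gset G E" "pts E = {}" and u: "gmap G E X u" and c: "c \<in> val M E"
  shows "mackey_unit G M X = lower M E X u c"
  unfolding mackey_unit_def
proof (rule the_equality)
  show "\<exists>E' i c'. pts E' = {} \<and> gmap G E' X i \<and> c' \<in> val M E' \<and> lower M E X u c = lower M E' X i c'"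
    using assms by blast
next
  fix e assume "\<exists>E i c. pts E = {} \<and> gmap G E X i \<and> c \<in> val M E \<and> e = lower M E X i c"
  then obtain E' i c' where E': "pts E' = {}" and i: "gmap G E' X i" and c': "c' \<in> val M E'"
    and e: "e = lower M E' X i c'" by blast
  note fE' = gmap_dom[OF i]
  have v: "gmap G E E' (\<lambda>x. undefined)" by (rule gmap_from_empty[OF E(1) fE' E(2)])
  have "lower M E X u c = lower M E' X i (lower M E E' (\<lambda>x. undefined) c)"
    by (rule lower_comp[OF v i u]) (simp_all add: E c)
  also have "lower M E E' (\<lambda>x. undefined) c = c'"
    by (rule val_empty_unique[OF fE' E']) (simp_all add: lower_closed[OF v] c c')
  finally show "e = lower M E X u c" using e by simp
qed

lemma mackey_unit_witness:
  assumes "fin_gset G X"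
  obtains E e where "fin_gset G E" "pts E = {}" "gmap G E X (\<lambda>x. undefined)" "e \<in> val M E"
    "mackey_unit G M X = lower M E X (\<lambda>x. undefined) e"
proof -
  obtain E :: "('g, 'u) gset" where E: "fin_gset G E" "pts E = {}" using empty_gset_exists .
  obtain e where "e \<in> val M E" using nonempty[OF E(1)] by blast
  then show ?thesis
    using that E gmap_from_empty[OF E(1) assms E(2)] mackey_unit_eq by metis
qed

text \<open>The map \<open>h\<close> factors as \<open>P \<rightarrow> Z \<amalg> Z \<rightarrow> Z\<close>, and the pullback squares over the two summands compute
  the components of the image of \<open>p\<close> in the middle. All monoid laws follow from this, since each of
  them compares two decompositions of one coproduct.\<close>

lemma lower_coproduct:
  assumes c: "coproduct_diagram G X Y P i j" and h: "gmap G P Z h"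
    and f: "gmap G X Z f" "\<And>x. x \<in> pts X \<Longrightarrow> h (i x) = f x"
    and k: "gmap G Y Z k" "\<And>y. y \<in> pts Y \<Longrightarrow> h (j y) = k y"
    and p: "p \<in> val M P"
  shows "lower M P Z h p =
    mackey_op G M Z (lower M X Z f (upper M X P i p)) (lower M Y Z k (upper M Y P j p))"
proof -
  note cD = coproductD[OF c]
  have Z: "fin_gset G Z" using h by (rule gmap_cod)
  obtain W i' j' d where c': "coproduct_diagram G Z Z W i' j'" and d: "gmap G W Z d"
    "\<And>x. x \<in> pts Z \<Longrightarrow> d (i' x) = x" "\<And>x. x \<in> pts Z \<Longrightarrow> d (j' x) = x"
    using fold_exists[OF Z] by blast
  note cD' = coproductD[OF c']
  obtain m where m: "gmap G P W m" "\<And>x. x \<in> pts X \<Longrightarrow> m (i x) = compose (pts X) i' f x"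
    "\<And>y. y \<in> pts Y \<Longrightarrow> m (j y) = compose (pts Y) j' k y"
    using copair_exists[OF c gmap_compose[OF f(1) cD'(1)] gmap_compose[OF k(1) cD'(2)]] by blast
  have "upper M Z W i' (lower M P W m p) = lower M X Z f (upper M X P i p)"
    by (rule upper_lower[OF pullback_summand[OF c c' f(1) m(1)] p])
      (auto simp: m compose_eq gmap_app[OF k(1)])
  moreover have "upper M Z W j' (lower M P W m p) = lower M Y Z k (upper M Y P j p)"
    by (rule upper_lower[OF pullback_summand[OF coproduct_swap[OF c] coproduct_swap[OF c'] k(1) m(1)] p])
      (auto simp: m compose_eq gmap_app[OF f(1)])
  moreover have "lower M P Z h p = lower M W Z d (lower M P W m p)"
  proof (rule lower_comp[OF m(1) d(1) h _ p])
    show "h x = d (m x)" if "x \<in> pts P" for x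
      using c that
      by (rule coproduct_cases)
        (auto simp: d m compose_eq f(2) k(2) gmap_app[OF f(1)] gmap_app[OF k(1)])
  qed
  ultimately show ?thesis
    using mackey_op_eq[OF c' d lower_closed[OF m(1) p]] by simp
qed

lemma op_closed:
  assumes X: "fin_gset G X" and ab: "a \<in> val M X" "b \<in> val M X"
  shows "mackey_op G M X a b \<in> val M X"
proof -
  obtain W i j d where c: "coproduct_diagram G X X W i j" and d: "gmap G W X d"
    "\<And>x. x \<in> pts X \<Longrightarrow> d (i x) = x" "\<And>x. x \<in> pts X \<Longrightarrow> d (j x) = x"
    using fold_exists[OF X] by blast
  obtain w where "w \<in> val M W" "upper M X W i w = a" "upper M X W j w = b"
    using glue_exists[OF c ab] .
  then show ?thesis using mackey_op_eq[OF c d] lower_closed[OF d(1)] by metis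
qed

lemma unit_closed: "fin_gset G X \<Longrightarrow> mackey_unit G M X \<in> val M X"
  using mackey_unit_witness lower_closed by metis

lemma op_commute:
  assumes X: "fin_gset G X" and ab: "a \<in> val M X" "b \<in> val M X"
  shows "mackey_op G M X a b = mackey_op G M X b a"
proof -
  obtain W i j d where c: "coproduct_diagram G X X W i j" and d: "gmap G W X d"
    "\<And>x. x \<in> pts X \<Longrightarrow> d (i x) = x" "\<And>x. x \<in> pts X \<Longrightarrow> d (j x) = x"
    using fold_exists[OF X] by blast
  obtain w where "w \<in> val M W" "upper M X W i w = a" "upper M X W j w = b"
    using glue_exists[OF c ab] .
  then show ?thesis
    using mackey_op_eq[OF c d] mackey_op_eq[OF coproduct_swap[OF c] d(1,3,2)] by metis
qed

text \<open>The decomposition \<open>X = X \<amalg> \<emptyset>\<close>.\<close>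

lemma op_unit:
  assumes X: "fin_gset G X" and a: "a \<in> val M X"
  shows "mackey_op G M X a (mackey_unit G M X) = a"
proof -
  obtain E e where E: "fin_gset G E" "pts E = {}" and u: "gmap G E X (\<lambda>x. undefined)"
    and e: "e \<in> val M E" and eq: "mackey_unit G M X = lower M E X (\<lambda>x. undefined) e"
    using mackey_unit_witness[OF X] .
  note id = gmap_id[OF X]
  have "lower M X X (\<lambda>x\<in>pts X. x) a =
    mackey_op G M X (lower M X X (\<lambda>x\<in>pts X. x) (upper M X X (\<lambda>x\<in>pts X. x) a))
      (lower M E X (\<lambda>x. undefined) (upper M E X (\<lambda>x. undefined) a))"
    by (rule lower_coproduct[OF coproduct_empty[OF X E] id id _ u _ a]) (simp_all add: E)
  moreover have "upper M E X (\<lambda>x. undefined) a = e"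
    by (rule val_empty_unique[OF E]) (simp_all add: upper_closed[OF u] a e)
  ultimately show ?thesis
    using a by (simp add: eq lower_id[OF id] upper_id[OF id])
qed

lemma op_assoc:
  assumes X: "fin_gset G X" and abc: "a \<in> val M X" "b \<in> val M X" "c \<in> val M X"
  shows "mackey_op G M X (mackey_op G M X a b) c = mackey_op G M X a (mackey_op G M X b c)"
proof -
  note id = gmap_id[OF X]
  obtain W i j d where W: "coproduct_diagram G X X W i j" and d: "gmap G W X d"
    "\<And>x. x \<in> pts X \<Longrightarrow> d (i x) = x" "\<And>x. x \<in> pts X \<Longrightarrow> d (j x) = x"
    using fold_exists[OF X] by blast
  note WD = coproductD[OF W]
  (* P is the threefold coproduct, bracketed as (X + X) + X *)
  obtain P k l where P: "coproduct_diagram G W X P k l"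
    using coproduct_exists[OF WD(9) X infinite_points] by blast
  note PD = coproductD[OF P]
  obtain h where h: "gmap G P X h" "\<And>w. w \<in> pts W \<Longrightarrow> h (k w) = d w"
    "\<And>x. x \<in> pts X \<Longrightarrow> h (l x) = x"
    using copair_exists[OF P d(1) id] by (metis restrict_apply')
  obtain m where m: "gmap G W P m" "\<And>x. x \<in> pts X \<Longrightarrow> m (i x) = compose (pts X) k j x"
    "\<And>x. x \<in> pts X \<Longrightarrow> m (j x) = l x"
    using copair_exists[OF W gmap_compose[OF WD(2) PD(1)] PD(2)] by blast
  let ?ki = "compose (pts X) k i"
  have ki: "gmap G X P ?ki" using WD(1) PD(1) by (rule gmap_compose)
  have kj: "gmap G X P (compose (pts X) k j)" using WD(2) PD(1) by (rule gmap_compose)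
  have app: "i x \<in> pts W" "j x \<in> pts W" if "x \<in> pts X" for x
    using that gmap_app WD by metis+
  (* the same P, bracketed as X + (X + X) *)
  have P': "coproduct_diagram G X W P ?ki m"
  proof (rule coproductI[OF ki m(1)])
    show "w = w'" if "w \<in> pts W" "w' \<in> pts W" "m w = m w'" for w w'
      by (rule coproduct_cases[OF W that(1)]; rule coproduct_cases[OF W that(2)])
        (use that(3) in \<open>auto simp: m compose_eq app PD WD\<close>)
    show "?ki x \<noteq> m w" if "x \<in> pts X" "w \<in> pts W" for x w
      using W that(2) by (rule coproduct_cases)
        (use that in \<open>auto simp: m compose_eq app PD WD\<close>)
    show "(\<exists>x\<in>pts X. p = ?ki x) \<or> (\<exists>w\<in>pts W. p = m w)" if "p \<in> pts P" for p
      using P that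
    proof (rule coproduct_cases)
      fix w assume "w \<in> pts W" and p: "p = k w"
      from W this(1) show ?thesis
        by (rule coproduct_cases) (use p m(2) app in \<open>auto simp: compose_eq intro!: bexI\<close>)
    qed (metis m(3) app(2))
  qed (auto simp: compose_eq app PD WD)
  obtain w where w: "w \<in> val M W" "upper M X W i w = a" "upper M X W j w = b"
    using glue_exists[OF W abc(1,2)] .
  obtain p where p: "p \<in> val M P" "upper M W P k p = w" "upper M X P l p = c"
    using glue_exists[OF P w(1) abc(3)] .
  have "lower M P X h p = mackey_op G M X (lower M W X d w) (lower M X X (\<lambda>x\<in>pts X. x) c)"
    using lower_coproduct[OF P h(1) d(1) h(2) id _ p(1)] h(3) p by simp
  moreover have "lower M W X d w = mackey_op G M X a b"
    using mackey_op_eq[OF W d w(1)] w by simp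
  moreover have "lower M X X (\<lambda>x\<in>pts X. x) c = c" using id abc by (simp add: lower_id)
  moreover have "lower M P X h p =
    mackey_op G M X (lower M X X (\<lambda>x\<in>pts X. x) (upper M X P ?ki p)) (lower M W X d (upper M W P m p))"
  proof (rule lower_coproduct[OF P' h(1) id _ d(1) _ p(1)])
    show "h (m w) = d w" if "w \<in> pts W" for w
      using W that by (rule coproduct_cases) (auto simp: m compose_eq h d app)
  qed (auto simp: compose_eq h d app)
  moreover have ki_p: "upper M X P ?ki p = a"
    using upper_comp[OF WD(1) PD(1) ki _ p(1)] w p by (simp add: compose_eq)
  moreover have "lower M X X (\<lambda>x\<in>pts X. x) (upper M X P ?ki p) = a"
    using ki_p id abc by (simp add: lower_id)
  moreover have "lower M W X d (upper M W P m p) = mackey_op G M X b c"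
  proof -
    have "upper M X W i (upper M W P m p) = upper M X P (compose (pts X) k j) p"
      by (rule upper_comp[symmetric, OF WD(1) m(1) kj _ p(1)]) (simp add: m)
    also have "\<dots> = b" using upper_comp[OF WD(2) PD(1) kj _ p(1)] w p by (simp add: compose_eq)
    finally have 1: "upper M X W i (upper M W P m p) = b" .
    have 2: "upper M X W j (upper M W P m p) = c"
      using upper_comp[OF WD(2) m(1) PD(2) _ p(1)] m(3) p(3) by simp
    show ?thesis using mackey_op_eq[OF W d upper_closed[OF m(1) p(1)]] 1 2 by simp
  qed
  ultimately show ?thesis by simp
qed

lemma mackey_comm_monoid: "fin_gset G X \<Longrightarrow> comm_monoid (mackey_monoid G M X)"
  by (rule comm_monoidI, simp_all add: mackey_monoid_def op_closed unit_closed op_assoc)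
    (metis op_commute op_unit unit_closed)+

lemma lower_op:
  assumes f: "gmap G X Y f" and ab: "a \<in> val M X" "b \<in> val M X"
  shows "lower M X Y f (mackey_op G M X a b) =
    mackey_op G M Y (lower M X Y f a) (lower M X Y f b)"
proof -
  obtain W i j d where c: "coproduct_diagram G X X W i j" and d: "gmap G W X d"
    "\<And>x. x \<in> pts X \<Longrightarrow> d (i x) = x" "\<And>x. x \<in> pts X \<Longrightarrow> d (j x) = x"
    using fold_exists[OF gmap_dom[OF f]] by blast
  note cD = coproductD[OF c]
  obtain w where w: "w \<in> val M W" "upper M X W i w = a" "upper M X W j w = b"
    using glue_exists[OF c ab] .
  let ?fd = "compose (pts W) f d"
  have fd: "gmap G W Y ?fd" using d(1) f by (rule gmap_compose)
  have "lower M X Y f (mackey_op G M X a b) = lower M W Y ?fd w"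
    using mackey_op_eq[OF c d w(1)] w lower_comp[OF d(1) f fd _ w(1)] by (simp add: compose_eq)
  also have "\<dots> = mackey_op G M Y (lower M X Y f a) (lower M X Y f b)"
    using lower_coproduct[OF c fd f _ f _ w(1)] w(2,3) gmap_app[OF cD(1)] gmap_app[OF cD(2)] d
    by (simp add: compose_eq)
  finally show ?thesis .
qed

lemma lower_unit:
  assumes f: "gmap G X Y f"
  shows "lower M X Y f (mackey_unit G M X) = mackey_unit G M Y"
proof -
  obtain E e where E: "fin_gset G E" "pts E = {}" and u: "gmap G E X (\<lambda>x. undefined)"
    and e: "e \<in> val M E" and eq: "mackey_unit G M X = lower M E X (\<lambda>x. undefined) e"
    using mackey_unit_witness[OF gmap_dom[OF f]] .
  have v: "gmap G E Y (\<lambda>x. undefined)" using gmap_from_empty[OF E(1) gmap_cod[OF f] E(2)] .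
  show ?thesis
    using lower_comp[OF u f v _ e] mackey_unit_eq[OF E v e] E eq by simp
qed

text \<open>The folding map of \<open>X\<close> is the pullback of the folding map of \<open>Y\<close> along \<open>f\<close>.\<close>

lemma upper_op:
  assumes f: "gmap G X Y f" and ab: "a \<in> val M Y" "b \<in> val M Y"
  shows "upper M X Y f (mackey_op G M Y a b) =
    mackey_op G M X (upper M X Y f a) (upper M X Y f b)"
proof -
  obtain W i j d where c: "coproduct_diagram G X X W i j" and d: "gmap G W X d"
    "\<And>x. x \<in> pts X \<Longrightarrow> d (i x) = x" "\<And>x. x \<in> pts X \<Longrightarrow> d (j x) = x"
    using fold_exists[OF gmap_dom[OF f]] by blast
  note cD = coproductD[OF c]
  obtain V i' j' e where c': "coproduct_diagram G Y Y V i' j'" and e: "gmap G V Y e"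
    "\<And>y. y \<in> pts Y \<Longrightarrow> e (i' y) = y" "\<And>y. y \<in> pts Y \<Longrightarrow> e (j' y) = y"
    using fold_exists[OF gmap_cod[OF f]] by blast
  note cD' = coproductD[OF c']
  have if': "gmap G X V (compose (pts X) i' f)" and jf': "gmap G X V (compose (pts X) j' f)"
    using f cD'(1,2) by (auto intro: gmap_compose)
  obtain m where m: "gmap G W V m" "\<And>x. x \<in> pts X \<Longrightarrow> m (i x) = compose (pts X) i' f x"
    "\<And>x. x \<in> pts X \<Longrightarrow> m (j x) = compose (pts X) j' f x"
    using copair_exists[OF c if' jf'] by blast
  obtain v where v: "v \<in> val M V" "upper M Y V i' v = a" "upper M Y V j' v = b"
    using glue_exists[OF c' ab] .
  have "pullback_square G X Y W V f e d m"
    by (rule pullback_fold[OF c c' d e f m(1)]) (simp_all add: m compose_eq)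
  then have "upper M X Y f (lower M V Y e v) = lower M W X d (upper M W V m v)"
    using v(1) by (rule upper_lower)
  also have "\<dots> = mackey_op G M X (upper M X W i (upper M W V m v)) (upper M X W j (upper M W V m v))"
    by (rule mackey_op_eq[symmetric, OF c d upper_closed[OF m(1) v(1)]])
  also have "upper M X W i (upper M W V m v) = upper M X V (compose (pts X) i' f) v"
    by (rule upper_comp[symmetric, OF cD(1) m(1) if' _ v(1)]) (simp add: m)
  also have "\<dots> = upper M X Y f a"
    using upper_comp[OF f cD'(1) if' _ v(1)] v by (simp add: compose_eq)
  also have "upper M X W j (upper M W V m v) = upper M X V (compose (pts X) j' f) v"
    by (rule upper_comp[symmetric, OF cD(2) m(1) jf' _ v(1)]) (simp add: m)
  also have "\<dots> = upper M X Y f b"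
    using upper_comp[OF f cD'(2) jf' _ v(1)] v by (simp add: compose_eq)
  finally show ?thesis using mackey_op_eq[OF c' e v(1)] v by simp
qed

lemma upper_unit:
  assumes f: "gmap G X Y f"
  shows "upper M X Y f (mackey_unit G M Y) = mackey_unit G M X"
proof -
  obtain E e where E: "fin_gset G E" "pts E = {}" and u: "gmap G E Y (\<lambda>x. undefined)"
    and e: "e \<in> val M E" and eq: "mackey_unit G M Y = lower M E Y (\<lambda>x. undefined) e"
    using mackey_unit_witness[OF gmap_cod[OF f]] .
  have v: "gmap G E X (\<lambda>x. undefined)" using gmap_from_empty[OF E(1) gmap_dom[OF f] E(2)] .
  have id: "gmap G E E (\<lambda>x. undefined)" using gmap_from_empty[OF E(1) E(1) E(2)] .
  have "pullback_square G X Y E E f (\<lambda>x. undefined) (\<lambda>x. undefined) (\<lambda>x. undefined)"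
    by (rule pullback_squareI[OF f u v id]) (simp_all add: E)
  then have "upper M X Y f (mackey_unit G M Y) =
    lower M E X (\<lambda>x. undefined) (upper M E E (\<lambda>x. undefined) e)"
    using e by (simp add: eq upper_lower)
  also have "\<dots> = mackey_unit G M X"
    by (rule mackey_unit_eq[symmetric, OF E v upper_closed[OF id e]])
  finally show ?thesis .
qed

text \<open>The fiber product \<open>X \<times>\<^sub>Y X\<close> splits into the diagonal, which contributes the factor \<open>c\<close>, and its
  complement \<open>C\<close>. In the multiplicative part of a Tambara functor this says that \<open>f\<^sup>*f\<^sub>\<bullet>(c)\<close> is a
  multiple of \<open>c\<close>, which makes localization compatible with transfers.\<close>

lemma upper_lower_self:
  assumes f: "gmap G X Y f"
  obtains C u v where "gmap G C X u" "gmap G C X v"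
    "\<And>c. c \<in> val M X \<Longrightarrow> upper M X Y f (lower M X Y f c) =
      mackey_op G M X c (lower M C X u (upper M C X v c))"
proof -
  note X = gmap_dom[OF f]
  obtain P k l where P: "pullback_square G X Y P X f f k l"
    using pullback_exists[OF f f infinite_points] .
  note k = pullbackD(3)[OF P] and l = pullbackD(4)[OF P]
  note PX = gmap_dom[OF k]
  have "\<forall>x\<in>pts X. \<exists>z\<in>pts P. k z = x \<and> l z = x" using pullbackD(6)[OF P] by simp
  then obtain \<delta> where \<delta>: "\<And>x. x \<in> pts X \<Longrightarrow> \<delta> x \<in> pts P \<and> k (\<delta> x) = x \<and> l (\<delta> x) = x"
    by (metis bchoice)
  have \<delta>_eq: "\<delta> (act X g x) = act P g (\<delta> x)" if gx: "g \<in> carrier G" "x \<in> pts X" for g x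
    using \<delta>[OF gx(2)] \<delta>[OF act_closed[OF X gx]]
    by - (rule pullbackD(7)[OF P],
      simp_all add: act_closed[OF PX gx(1)] gmap_equiv[OF k gx(1)] gmap_equiv[OF l gx(1)])
  define D where "D = (\<lambda>x\<in>pts X. \<delta> x)"
  have D: "gmap G X P D" unfolding D_def by (rule gmap_restrict) (auto simp: X PX \<delta> \<delta>_eq)
  have kD: "k (D x) = x" "l (D x) = x" if "x \<in> pts X" for x using that \<delta> by (auto simp: D_def)
  obtain C \<kappa> where C: "coproduct_diagram G X C P D \<kappa>"
    using complement_exists[OF D] kD(1) by (metis (no_types, lifting))
  note \<kappa> = coproductD(2)[OF C]
  let ?u = "compose (pts C) k \<kappa>" and ?v = "compose (pts C) l \<kappa>"
  have u: "gmap G C X ?u" and v: "gmap G C X ?v" using \<kappa> k l by (auto intro: gmap_compose)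
  note id = gmap_id[OF X]
  show ?thesis
  proof (rule that[OF u v])
    fix c assume c: "c \<in> val M X"
    have "upper M X Y f (lower M X Y f c) = lower M P X k (upper M P X l c)"
      using P c by (rule upper_lower)
    also have "\<dots> = mackey_op G M X
        (lower M X X (\<lambda>x\<in>pts X. x) (upper M X P D (upper M P X l c)))
        (lower M C X ?u (upper M C P \<kappa> (upper M P X l c)))"
      by (rule lower_coproduct[OF C k id _ u _ upper_closed[OF l c]]) (simp_all add: kD compose_eq)
    also have "upper M X P D (upper M P X l c) = upper M X X (\<lambda>x\<in>pts X. x) c"
      by (rule upper_comp[symmetric, OF D l id _ c]) (simp add: kD)
    also have "upper M C P \<kappa> (upper M P X l c) = upper M C X ?v c"
      by (rule upper_comp[symmetric, OF \<kappa> l v _ c]) (simp add: compose_eq)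
    also have "upper M X X (\<lambda>x\<in>pts X. x) c = c" by (rule upper_id[OF id _ c]) simp
    also have "lower M X X (\<lambda>x\<in>pts X. x) c = c" by (rule lower_id[OF id _ c]) simp
    finally show "upper M X Y f (lower M X Y f c) =
        mackey_op G M X c (lower M C X ?u (upper M C X ?v c))" .
  qed
qed

end

section \<open>The rings of a Tambara functor\<close>

locale tambara = group G for G :: "('g, 'm) monoid_scheme" (structure) +
  fixes T :: "('g, 'u, 'a) tambara_data"
  assumes infinite_points: "infinite (UNIV :: 'u set)"
    and tambara: "tambara_functor G T"
begin

abbreviation "R \<equiv> tambara_ring G T"

lemma add_comm_group: "fin_gset G X \<Longrightarrow> comm_group (mackey_monoid G (add_part T) X)"
  using tambara by (simp add: tambara_functor_def mackey_functor_def)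

lemma tval_nonempty: "fin_gset G X \<Longrightarrow> tval T X \<noteq> {}"
  using add_comm_group[of X] monoid.one_closed[of "mackey_monoid G (add_part T) X"]
  by (auto simp: comm_group_def comm_monoid_def mackey_monoid_def add_part_def)

sublocale add: semi_mackey G "add_part T"
  rewrites "val (add_part T) = tval T" and "upper (add_part T) = res T"
    and "lower (add_part T) = trf T"
proof -
  show "semi_mackey G (add_part T)"
    using infinite_points tambara tval_nonempty
    by unfold_locales (simp_all add: tambara_functor_def mackey_functor_def add_part_def)
qed (simp_all add: add_part_def)

sublocale mul: semi_mackey G "mult_part T"
  rewrites "val (mult_part T) = tval T" and "upper (mult_part T) = res T"
    and "lower (mult_part T) = nrm T"
proof -
  show "semi_mackey G (mult_part T)"
    using infinite_points tambara tval_nonempty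
    by unfold_locales (simp_all add: tambara_functor_def mult_part_def)
qed (simp_all add: mult_part_def)

lemma carrier_ring [simp]: "carrier (R X) = tval T X"
  by (simp add: tambara_ring_def)

lemma ring_sel:
  "mult (R X) = mackey_op G (mult_part T) X"
  "one (R X) = mackey_unit G (mult_part T) X" "ring.zero (R X) = mackey_unit G (add_part T) X"
  "ring.add (R X) = mackey_op G (add_part T) X"
  by (simp_all add: tambara_ring_def)

lemma exponential:
  "exponential_diagram G X Y A Z B f p l r q \<Longrightarrow> a \<in> tval T A \<Longrightarrow>
    nrm T X Y f (trf T A X p a) = trf T B Y q (nrm T Z B r (res T Z A l a))"
  using tambara unfolding tambara_functor_def by blast

text \<open>Frobenius reciprocity. Apply the distributive law of \<open>exponential_fold\<close> to the element of
  \<open>T(Y \<amalg> X)\<close> with components \<open>y\<close> and \<open>x\<close>: the norm along the folding map multiplies, first \<open>y\<close> with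
  \<open>f\<^sub>+(x)\<close> over \<open>Y\<close>, then \<open>f\<^sup>*(y)\<close> with \<open>x\<close> over \<open>X\<close>.\<close>

lemma projection_formula:
  assumes f: "gmap G X Y f" and y: "y \<in> tval T Y" and x: "x \<in> tval T X"
  shows "mackey_op G (mult_part T) Y y (trf T X Y f x) =
    trf T X Y f (mackey_op G (mult_part T) X (res T X Y f y) x)"
proof -
  note X = gmap_dom[OF f] and Y = gmap_cod[OF f]
  note id = gmap_id[OF Y]
  obtain V i j d where V: "coproduct_diagram G Y Y V i j" and d: "gmap G V Y d"
    "\<And>y. y \<in> pts Y \<Longrightarrow> d (i y) = y" "\<And>y. y \<in> pts Y \<Longrightarrow> d (j y) = y"
    using add.fold_exists[OF Y] by blast
  obtain W m n e where W: "coproduct_diagram G X X W m n" and e: "gmap G W X e"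
    "\<And>x. x \<in> pts X \<Longrightarrow> e (m x) = x" "\<And>x. x \<in> pts X \<Longrightarrow> e (n x) = x"
    using add.fold_exists[OF X] by blast
  obtain A k l where A: "coproduct_diagram G Y X A k l"
    using coproduct_exists[OF Y X infinite_points] .
  note VD = coproductD[OF V] and AD = coproductD[OF A] and WD = coproductD[OF W]
  have jf: "gmap G X V (compose (pts X) j f)" using f VD(2) by (rule gmap_compose)
  have kf: "gmap G X A (compose (pts X) k f)" using f AD(1) by (rule gmap_compose)
  obtain p where p: "gmap G A V p" "\<And>y. y \<in> pts Y \<Longrightarrow> p (k y) = i y"
      "\<And>x. x \<in> pts X \<Longrightarrow> p (l x) = compose (pts X) j f x"
    using copair_exists[OF A VD(1) jf] by blast
  obtain r where r: "gmap G W A r" "\<And>x. x \<in> pts X \<Longrightarrow> r (m x) = compose (pts X) k f x"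
      "\<And>x. x \<in> pts X \<Longrightarrow> r (n x) = l x"
    using copair_exists[OF W kf AD(2)] by blast
  have exp: "exponential_diagram G V Y A W X d p r e f"
    using p(2,3) r(2,3)
    by (intro exponential_fold[OF f V d A p(1) _ _ W e r(1)]) (simp_all add: compose_eq)
  obtain a where a: "a \<in> tval T A" "res T Y A k a = y" "res T X A l a = x"
    using add.glue_exists[OF A y x] .
  have "res T Y V i (trf T A V p a) = trf T Y Y (\<lambda>y\<in>pts Y. y) (res T Y A k a)"
    by (rule add.upper_lower[OF pullback_summand[OF A V id p(1)] a(1)])
      (auto simp: p compose_eq gmap_app[OF f])
  then have i: "res T Y V i (trf T A V p a) = y" using a y by (simp add: add.lower_id[OF id])
  have "res T Y V j (trf T A V p a) = trf T X Y f (res T X A l a)"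
    by (rule add.upper_lower[OF pullback_summand[OF coproduct_swap[OF A] coproduct_swap[OF V] f p(1)] a(1)])
      (auto simp: p compose_eq)
  then have j: "res T Y V j (trf T A V p a) = trf T X Y f x" using a by simp
  have "mackey_op G (mult_part T) Y y (trf T X Y f x) = nrm T V Y d (trf T A V p a)"
    using mul.mackey_op_eq[OF V d add.lower_closed[OF p(1) a(1)]] i j by simp
  also have "\<dots> = trf T X Y f (nrm T W X e (res T W A r a))" using exp a(1) by (rule exponential)
  also have "nrm T W X e (res T W A r a) =
      mackey_op G (mult_part T) X (res T X W m (res T W A r a)) (res T X W n (res T W A r a))"
    by (rule mul.mackey_op_eq[symmetric, OF W e add.upper_closed[OF r(1) a(1)]])
  also have "res T X W m (res T W A r a) = res T X A (compose (pts X) k f) a"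
    by (rule add.upper_comp[symmetric, OF WD(1) r(1) kf _ a(1)]) (simp add: r)
  also have "\<dots> = res T X Y f y"
    using add.upper_comp[OF f AD(1) kf _ a(1)] a by (simp add: compose_eq)
  also have "res T X W n (res T W A r a) = x"
    using add.upper_comp[OF WD(2) r(1) AD(2) _ a(1)] r a by simp
  finally show ?thesis .
qed

text \<open>Distributivity is the projection formula for the folding map.\<close>

lemma cring_tambara:
  assumes X: "fin_gset G X"
  shows "cring (R X)"
proof (rule cringI)
  have "add_monoid (R X) = mackey_monoid G (add_part T) X"
    by (simp add: mackey_monoid_def add_part_def ring_sel)
  with add_comm_group[OF X] have G: "comm_group (add_monoid (R X))" by simp
  then have "abelian_monoid (R X)" by (simp add: abelian_monoid_def comm_group_def)
  with G show "abelian_group (R X)"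
    by (simp add: abelian_group_def abelian_group_axioms_def)
  show M: "comm_monoid (R X)"
    by (rule comm_monoidI, simp_all add: ring_sel mul.op_closed mul.unit_closed mul.op_assoc X)
      (metis mul.op_commute mul.op_unit mul.unit_closed X)+
  fix b c a assume abc: "b \<in> carrier (R X)" "c \<in> carrier (R X)" "a \<in> carrier (R X)"
  then have T: "a \<in> tval T X" "b \<in> tval T X" "c \<in> tval T X" by auto
  obtain W i j d where W: "coproduct_diagram G X X W i j" and d: "gmap G W X d"
    "\<And>x. x \<in> pts X \<Longrightarrow> d (i x) = x" "\<And>x. x \<in> pts X \<Longrightarrow> d (j x) = x"
    using add.fold_exists[OF X] by blast
  note WD = coproductD[OF W]
  note id = gmap_id[OF X]
  obtain w where w: "w \<in> tval T W" "res T X W i w = b" "res T X W j w = c"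
    using add.glue_exists[OF W T(2,3)] .
  let ?m = "mackey_op G (mult_part T)" and ?p = "mackey_op G (add_part T)"
  have da: "res T W X d a \<in> tval T W" using d(1) T(1) by (rule add.upper_closed)
  have ida: "res T X W i (res T W X d a) = a" "res T X W j (res T W X d a) = a"
    using add.upper_comp[OF WD(1) d(1) id _ T(1)] add.upper_comp[OF WD(2) d(1) id _ T(1)] d T(1)
    by (simp_all add: add.upper_id[OF id])
  have daw: "?m W (res T W X d a) w \<in> tval T W" by (rule mul.op_closed[OF WD(9) da w(1)])
  have "?m X a (?p X b c) = ?m X a (trf T W X d w)"
    using add.mackey_op_eq[OF W d w(1)] w by simp
  also have "\<dots> = trf T W X d (?m W (res T W X d a) w)"
    using d(1) T(1) w(1) by (rule projection_formula)
  also have "\<dots> = ?p X (res T X W i (?m W (res T W X d a) w)) (res T X W j (?m W (res T W X d a) w))"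
    by (rule add.mackey_op_eq[symmetric, OF W d daw])
  also have "\<dots> = ?p X (?m X a b) (?m X a c)"
    by (simp add: mul.upper_op[OF WD(1) da w(1)] mul.upper_op[OF WD(2) da w(1)] ida w)
  finally show "(b \<oplus>\<^bsub>R X\<^esub> c) \<otimes>\<^bsub>R X\<^esub> a = b \<otimes>\<^bsub>R X\<^esub> a \<oplus>\<^bsub>R X\<^esub> c \<otimes>\<^bsub>R X\<^esub> a"
    using T X by (simp add: ring_sel mul.op_commute[OF X _ T(1)] add.op_closed)
qed

lemma
  assumes "gmap G X Y f"
  shows res_closed: "y \<in> tval T Y \<Longrightarrow> res T X Y f y \<in> tval T X"
    and trf_closed: "x \<in> tval T X \<Longrightarrow> trf T X Y f x \<in> tval T Y"
    and nrm_closed: "x \<in> tval T X \<Longrightarrow> nrm T X Y f x \<in> tval T Y"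
    and res_mult: "y \<in> tval T Y \<Longrightarrow> y' \<in> tval T Y \<Longrightarrow>
      res T X Y f (y \<otimes>\<^bsub>R Y\<^esub> y') = res T X Y f y \<otimes>\<^bsub>R X\<^esub> res T X Y f y'"
    and res_one: "res T X Y f \<one>\<^bsub>R Y\<^esub> = \<one>\<^bsub>R X\<^esub>"
    and nrm_mult: "x \<in> tval T X \<Longrightarrow> x' \<in> tval T X \<Longrightarrow>
      nrm T X Y f (x \<otimes>\<^bsub>R X\<^esub> x') = nrm T X Y f x \<otimes>\<^bsub>R Y\<^esub> nrm T X Y f x'"
    and nrm_one: "nrm T X Y f \<one>\<^bsub>R X\<^esub> = \<one>\<^bsub>R Y\<^esub>"
    and trf_zero: "trf T X Y f \<zero>\<^bsub>R X\<^esub> = \<zero>\<^bsub>R Y\<^esub>"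
    and projection: "y \<in> tval T Y \<Longrightarrow> x \<in> tval T X \<Longrightarrow>
      trf T X Y f (res T X Y f y \<otimes>\<^bsub>R X\<^esub> x) = y \<otimes>\<^bsub>R Y\<^esub> trf T X Y f x"
  using assms
  by (simp_all add: add.upper_closed add.lower_closed mul.lower_closed mul.upper_op mul.upper_unit
      mul.lower_op mul.lower_unit add.lower_unit projection_formula ring_sel)

lemma mult_closed: "fin_gset G X \<Longrightarrow> x \<in> tval T X \<Longrightarrow> y \<in> tval T X \<Longrightarrow> x \<otimes>\<^bsub>R X\<^esub> y \<in> tval T X"
  by (simp add: ring_sel mul.op_closed)

lemma
  assumes f: "gmap G X Y f" and h: "gmap G Y Z h"
  shows res_compose: "z \<in> tval T Z \<Longrightarrow>
      res T X Z (compose (pts X) h f) z = res T X Y f (res T Y Z h z)"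
    and trf_compose: "x \<in> tval T X \<Longrightarrow>
      trf T X Z (compose (pts X) h f) x = trf T Y Z h (trf T X Y f x)"
    and nrm_compose: "x \<in> tval T X \<Longrightarrow>
      nrm T X Z (compose (pts X) h f) x = nrm T Y Z h (nrm T X Y f x)"
  using add.upper_comp[OF f h gmap_compose[OF f h]] add.lower_comp[OF f h gmap_compose[OF f h]]
    mul.lower_comp[OF f h gmap_compose[OF f h]]
  by (simp_all add: compose_eq)

lemma
  assumes X: "fin_gset G X" and x: "x \<in> tval T X"
  shows res_id: "res T X X (\<lambda>x\<in>pts X. x) x = x"
    and trf_id: "trf T X X (\<lambda>x\<in>pts X. x) x = x"
    and nrm_id: "nrm T X X (\<lambda>x\<in>pts X. x) x = x"
  by (rule add.upper_id[OF gmap_id[OF X] _ x] add.lower_id[OF gmap_id[OF X] _ x]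
      mul.lower_id[OF gmap_id[OF X] _ x], simp)+

lemma fold_retract:
  assumes c: "coproduct_diagram G X X W i j" and d: "gmap G W X d"
    "\<And>x. x \<in> pts X \<Longrightarrow> d (i x) = x" "\<And>x. x \<in> pts X \<Longrightarrow> d (j x) = x"
    and x: "x \<in> tval T X"
  shows "res T X W i (res T W X d x) = x" "res T X W j (res T W X d x) = x"
proof -
  note cD = coproductD[OF c]
  have "compose (pts X) d i = (\<lambda>x\<in>pts X. x)" "compose (pts X) d j = (\<lambda>x\<in>pts X. x)"
    using d by (auto simp: compose_def)
  then show "res T X W i (res T W X d x) = x" "res T X W j (res T W X d x) = x"
    using res_compose[OF cD(1) d(1) x] res_compose[OF cD(2) d(1) x] res_id[OF cD(7) x] by simp_all
qed

end

section \<open>Fractions\<close>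

locale ring_localization = cring R for R (structure) +
  fixes S
  assumes denominators: "S \<subseteq> carrier R" "\<one> \<in> S" "s \<in> S \<Longrightarrow> t \<in> S \<Longrightarrow> s \<otimes> t \<in> S"
begin

lemma denominator_carrier: "s \<in> S \<Longrightarrow> s \<in> carrier R"
  using denominators(1) by blast

text \<open>Phrased without subtraction, equality of fractions is visibly preserved by maps that are
  only multiplicative, such as norms.\<close>

lemma frac_rel_iff:
  "((x, s), (y, t)) \<in> frac_rel R S \<longleftrightarrow> x \<in> carrier R \<and> s \<in> S \<and> y \<in> carrier R \<and> t \<in> S \<and>
    (\<exists>u\<in>S. u \<otimes> (x \<otimes> t) = u \<otimes> (y \<otimes> s))"
proof -
  have "u \<otimes> (x \<otimes> t \<ominus> y \<otimes> s) = \<zero> \<longleftrightarrow> u \<otimes> (x \<otimes> t) = u \<otimes> (y \<otimes> s)"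
    if "x \<in> carrier R" "s \<in> S" "y \<in> carrier R" "t \<in> S" "u \<in> S" for u
  proof -
    have cl: "u \<in> carrier R" "x \<otimes> t \<in> carrier R" "y \<otimes> s \<in> carrier R"
      using that denominator_carrier by auto
    then have "u \<otimes> (x \<otimes> t \<ominus> y \<otimes> s) = u \<otimes> (x \<otimes> t) \<ominus> u \<otimes> (y \<otimes> s)"
      by (simp add: minus_eq r_distr r_minus)
    moreover have "a \<ominus> b = \<zero> \<longleftrightarrow> a = b" if "a \<in> carrier R" "b \<in> carrier R" for a b
      using that minus_equality[of a "\<ominus> b"] by (auto simp: minus_eq r_neg)
    ultimately show ?thesis using cl by simp
  qed
  then show ?thesis unfolding frac_rel_def by auto
qed

lemma equiv_frac_rel: "equiv (carrier R \<times> S) (frac_rel R S)"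
proof (rule equivI)
  show "frac_rel R S \<subseteq> (carrier R \<times> S) \<times> carrier R \<times> S"
    by (auto simp: frac_rel_iff)
  show "refl_on (carrier R \<times> S) (frac_rel R S)"
    using denominators(2) by (auto simp: refl_on_def frac_rel_iff)
  show "sym (frac_rel R S)"
    unfolding sym_def by (auto simp: frac_rel_iff) metis
  show "trans (frac_rel R S)"
  proof (rule transI, clarify)
    fix x s y t z w
    assume "((x, s), y, t) \<in> frac_rel R S" "((y, t), z, w) \<in> frac_rel R S"
    then obtain u v where S: "s \<in> S" "t \<in> S" "w \<in> S" "u \<in> S" "v \<in> S"
      and xyz: "x \<in> carrier R" "y \<in> carrier R" "z \<in> carrier R"
      and u: "u \<otimes> (x \<otimes> t) = u \<otimes> (y \<otimes> s)" and v: "v \<otimes> (y \<otimes> w) = v \<otimes> (z \<otimes> t)"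
      by (auto simp: frac_rel_iff)
    note cl = S[THEN denominator_carrier] xyz
    have "(u \<otimes> v \<otimes> t) \<otimes> (x \<otimes> w) = (v \<otimes> w) \<otimes> (u \<otimes> (x \<otimes> t))" using cl by (simp add: m_ac)
    also have "\<dots> = (u \<otimes> s) \<otimes> (v \<otimes> (y \<otimes> w))" unfolding u using cl by (simp add: m_ac)
    also have "\<dots> = (u \<otimes> v \<otimes> t) \<otimes> (z \<otimes> s)" unfolding v using cl by (simp add: m_ac)
    finally show "((x, s), z, w) \<in> frac_rel R S"
      using S xyz denominators(3) by (auto simp: frac_rel_iff)
  qed
qed

lemma frac_eq_iff:
  assumes "x \<in> carrier R" "s \<in> S" "y \<in> carrier R" "t \<in> S"
  shows "frac R S x s = frac R S y t \<longleftrightarrow> (\<exists>u\<in>S. u \<otimes> (x \<otimes> t) = u \<otimes> (y \<otimes> s))"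
  unfolding frac_def using assms
  by (subst eq_equiv_class_iff[OF equiv_frac_rel]) (auto simp: frac_rel_iff)

lemma frac_scale:
  assumes "x \<in> carrier R" "s \<in> S" "a \<in> carrier R" "a \<otimes> s \<in> S"
  shows "frac R S (a \<otimes> x) (a \<otimes> s) = frac R S x s"
  using assms denominators(2) denominator_carrier[OF assms(2)]
  by (subst frac_eq_iff) (auto simp: m_ac)

lemma frac_carrier: "x \<in> carrier R \<Longrightarrow> s \<in> S \<Longrightarrow> frac R S x s \<in> carrier (localization R S)"
  by (simp add: localization_def frac_def quotientI)

lemma localization_cases:
  assumes "C \<in> carrier (localization R S)"
  obtains x s where "x \<in> carrier R" "s \<in> S" "C = frac R S x s"
  using assms unfolding localization_def frac_def by (auto elim!: quotientE)

lemma frac_UN: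
  assumes xs: "x \<in> carrier R" "s \<in> S"
    and F: "\<And>y t. y \<in> carrier R \<Longrightarrow> t \<in> S \<Longrightarrow> frac R S y t = frac R S x s \<Longrightarrow> F y t = F x s"
  shows "(\<Union>(y, t)\<in>frac R S x s. F y t) = F x s"
proof -
  have "F y t = F x s" if "(y, t) \<in> frac R S x s" for y t
  proof (rule F)
    have rel: "((x, s), (y, t)) \<in> frac_rel R S" using that by (simp add: frac_def)
    then show "y \<in> carrier R" "t \<in> S" by (auto simp: frac_rel_iff)
    show "frac R S y t = frac R S x s"
      unfolding frac_def using equiv_class_eq[OF equiv_frac_rel rel] by simp
  qed
  moreover have "(x, s) \<in> frac R S x s"
    unfolding frac_def using equiv_class_self[OF equiv_frac_rel] xs by simp
  ultimately show ?thesis by fast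
qed

lemma mult_frac:
  assumes x: "x \<in> carrier R" "s \<in> S" and y: "y \<in> carrier R" "t \<in> S"
  shows "frac R S x s \<otimes>\<^bsub>localization R S\<^esub> frac R S y t = frac R S (x \<otimes> y) (s \<otimes> t)"
proof -
  have eq: "frac R S (x' \<otimes> y') (s' \<otimes> t') = frac R S (x \<otimes> y) (s \<otimes> t)"
    if x': "x' \<in> carrier R" "s' \<in> S" "frac R S x' s' = frac R S x s"
      and y': "y' \<in> carrier R" "t' \<in> S" "frac R S y' t' = frac R S y t" for x' s' y' t'
  proof -
    obtain u where u: "u \<in> S" "u \<otimes> (x' \<otimes> s) = u \<otimes> (x \<otimes> s')"
      using x x' by (auto simp: frac_eq_iff)
    obtain v where v: "v \<in> S" "v \<otimes> (y' \<otimes> t) = v \<otimes> (y \<otimes> t')"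
      using y y' by (auto simp: frac_eq_iff)
    note cl = x y x' y' u(1) v(1) denominator_carrier
    have "(u \<otimes> v) \<otimes> ((x' \<otimes> y') \<otimes> (s \<otimes> t)) = (u \<otimes> (x' \<otimes> s)) \<otimes> (v \<otimes> (y' \<otimes> t))"
      using cl by (simp add: m_ac)
    also have "\<dots> = (u \<otimes> v) \<otimes> ((x \<otimes> y) \<otimes> (s' \<otimes> t'))"
      unfolding u(2) v(2) using cl by (simp add: m_ac)
    finally show ?thesis using cl denominators(3) by (subst frac_eq_iff) auto
  qed
  have inner: "(\<Union>(y', t')\<in>frac R S y t. frac R S (x' \<otimes> y') (s' \<otimes> t')) = frac R S (x \<otimes> y) (s \<otimes> t)"
    if x': "x' \<in> carrier R" "s' \<in> S" "frac R S x' s' = frac R S x s" for x' s'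
  proof -
    have "(\<Union>(y', t')\<in>frac R S y t. frac R S (x' \<otimes> y') (s' \<otimes> t')) = frac R S (x' \<otimes> y) (s' \<otimes> t)"
      by (rule frac_UN[OF y, where F = "\<lambda>y' t'. frac R S (x' \<otimes> y') (s' \<otimes> t')"])
        (simp only: eq[OF x'] y)
    then show ?thesis using eq[OF x' y refl] by simp
  qed
  have "frac R S x s \<otimes>\<^bsub>localization R S\<^esub> frac R S y t =
      (\<Union>(x', s')\<in>frac R S x s. \<Union>(y', t')\<in>frac R S y t. frac R S (x' \<otimes> y') (s' \<otimes> t'))"
    by (simp add: localization_def)
  also have "\<dots> = (\<Union>(y', t')\<in>frac R S y t. frac R S (x \<otimes> y') (s \<otimes> t'))"
    by (rule frac_UN[OF x, where F = "\<lambda>x' s'. \<Union>(y', t')\<in>frac R S y t. frac R S (x' \<otimes> y') (s' \<otimes> t')"])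
      (simp only: inner x)
  also have "\<dots> = frac R S (x \<otimes> y) (s \<otimes> t)" using inner[OF x refl] .
  finally show ?thesis .
qed

lemma add_frac:
  assumes x: "x \<in> carrier R" "s \<in> S" and y: "y \<in> carrier R" "t \<in> S"
  shows "frac R S x s \<oplus>\<^bsub>localization R S\<^esub> frac R S y t =
    frac R S (x \<otimes> t \<oplus> y \<otimes> s) (s \<otimes> t)"
proof -
  have eq: "frac R S (x' \<otimes> t' \<oplus> y' \<otimes> s') (s' \<otimes> t') = frac R S (x \<otimes> t \<oplus> y \<otimes> s) (s \<otimes> t)"
    if x': "x' \<in> carrier R" "s' \<in> S" "frac R S x' s' = frac R S x s"
      and y': "y' \<in> carrier R" "t' \<in> S" "frac R S y' t' = frac R S y t" for x' s' y' t'
  proof -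
    obtain u where u: "u \<in> S" "u \<otimes> (x' \<otimes> s) = u \<otimes> (x \<otimes> s')"
      using x x' by (auto simp: frac_eq_iff)
    obtain v where v: "v \<in> S" "v \<otimes> (y' \<otimes> t) = v \<otimes> (y \<otimes> t')"
      using y y' by (auto simp: frac_eq_iff)
    note cl = x y x' y' u(1) v(1) denominator_carrier
    have "(u \<otimes> v) \<otimes> ((x' \<otimes> t' \<oplus> y' \<otimes> s') \<otimes> (s \<otimes> t)) =
        (u \<otimes> (x' \<otimes> s)) \<otimes> (v \<otimes> (t' \<otimes> t)) \<oplus> (v \<otimes> (y' \<otimes> t)) \<otimes> (u \<otimes> (s' \<otimes> s))"
      using cl by (simp add: m_ac l_distr r_distr)
    also have "\<dots> = (u \<otimes> v) \<otimes> ((x \<otimes> t \<oplus> y \<otimes> s) \<otimes> (s' \<otimes> t'))"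
      unfolding u(2) v(2) using cl by (simp add: m_ac l_distr r_distr)
    finally show ?thesis using cl denominators(3) by (subst frac_eq_iff) auto
  qed
  have inner: "(\<Union>(y', t')\<in>frac R S y t. frac R S (x' \<otimes> t' \<oplus> y' \<otimes> s') (s' \<otimes> t')) = frac R S (x \<otimes> t \<oplus> y \<otimes> s) (s \<otimes> t)"
    if x': "x' \<in> carrier R" "s' \<in> S" "frac R S x' s' = frac R S x s" for x' s'
  proof -
    have "(\<Union>(y', t')\<in>frac R S y t. frac R S (x' \<otimes> t' \<oplus> y' \<otimes> s') (s' \<otimes> t')) = frac R S (x' \<otimes> t \<oplus> y \<otimes> s') (s' \<otimes> t)"
      by (rule frac_UN[OF y, where F = "\<lambda>y' t'. frac R S (x' \<otimes> t' \<oplus> y' \<otimes> s') (s' \<otimes> t')"])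
        (simp only: eq[OF x'] y)
    then show ?thesis using eq[OF x' y refl] by simp
  qed
  have "frac R S x s \<oplus>\<^bsub>localization R S\<^esub> frac R S y t =
      (\<Union>(x', s')\<in>frac R S x s. \<Union>(y', t')\<in>frac R S y t. frac R S (x' \<otimes> t' \<oplus> y' \<otimes> s') (s' \<otimes> t'))"
    by (simp add: localization_def)
  also have "\<dots> = (\<Union>(y', t')\<in>frac R S y t. frac R S (x \<otimes> t' \<oplus> y' \<otimes> s) (s \<otimes> t'))"
    by (rule frac_UN[OF x, where F = "\<lambda>x' s'. \<Union>(y', t')\<in>frac R S y t. frac R S (x' \<otimes> t' \<oplus> y' \<otimes> s') (s' \<otimes> t')"])
      (simp only: inner x)
  also have "\<dots> = frac R S (x \<otimes> t \<oplus> y \<otimes> s) (s \<otimes> t)" using inner[OF x refl] .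
  finally show ?thesis .
qed

end

section \<open>The localized Tambara functor\<close>

locale tambara_localization = tambara G T for G :: "('g, 'm) monoid_scheme" (structure)
    and T :: "('g, 'u, 'a) tambara_data" +
  fixes S :: "('g, 'u) gset \<Rightarrow> 'a set"
  assumes subfunctor: "semi_mackey_subfunctor G (mult_part T) S"
begin

abbreviation "fr \<equiv> tfrac G T S"

lemma
  assumes "fin_gset G X"
  shows S_sub: "s \<in> S X \<Longrightarrow> s \<in> tval T X" and S_one: "\<one>\<^bsub>R X\<^esub> \<in> S X"
    and S_mult: "s \<in> S X \<Longrightarrow> t \<in> S X \<Longrightarrow> s \<otimes>\<^bsub>R X\<^esub> t \<in> S X"
proof -
  have "submonoid (S X) (mackey_monoid G (mult_part T) X)"
    using subfunctor assms by (simp add: semi_mackey_subfunctor_def)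
  note sub = submonoid.subset[OF this] submonoid.one_closed[OF this] submonoid.m_closed[OF this]
  show "s \<in> S X \<Longrightarrow> s \<in> tval T X" "\<one>\<^bsub>R X\<^esub> \<in> S X"
    "s \<in> S X \<Longrightarrow> t \<in> S X \<Longrightarrow> s \<otimes>\<^bsub>R X\<^esub> t \<in> S X"
    using sub by (auto simp: mackey_monoid_def tambara_ring_def mult_part_def)
qed

lemma
  assumes "gmap G X Y f"
  shows S_res: "t \<in> S Y \<Longrightarrow> res T X Y f t \<in> S X" and S_nrm: "s \<in> S X \<Longrightarrow> nrm T X Y f s \<in> S Y"
proof -
  have "upper (mult_part T) X Y f ` S Y \<subseteq> S X \<and> lower (mult_part T) X Y f ` S X \<subseteq> S Y"
    using subfunctor assms unfolding semi_mackey_subfunctor_def by blast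
  then show "t \<in> S Y \<Longrightarrow> res T X Y f t \<in> S X" "s \<in> S X \<Longrightarrow> nrm T X Y f s \<in> S Y"
    by (auto simp: mult_part_def)
qed

text \<open>An element over a coproduct is the product of the norms of its components, so it is a
  denominator as soon as the components are.\<close>

lemma S_glue:
  assumes c: "coproduct_diagram G X Y Z i j" and s: "s \<in> S X" and t: "t \<in> S Y"
  obtains w where "w \<in> S Z" "res T X Z i w = s" "res T Y Z j w = t"
proof -
  note cD = coproductD[OF c]
  obtain w where w: "w \<in> tval T Z" "res T X Z i w = s" "res T Y Z j w = t"
    using add.glue_exists[OF c] S_sub[OF cD(7) s] S_sub[OF cD(8) t] by metis
  note id = gmap_id[OF cD(9)]
  have "w = nrm T Z Z (\<lambda>z\<in>pts Z. z) w" using nrm_id[OF cD(9) w(1)] by simp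
  also have "\<dots> = nrm T X Z i s \<otimes>\<^bsub>R Z\<^esub> nrm T Y Z j t"
    using mul.lower_coproduct[OF c id cD(1) _ cD(2) _ w(1)] gmap_app[OF cD(1)] gmap_app[OF cD(2)] w
    by (simp add: ring_sel)
  finally have "w \<in> S Z" using S_mult S_nrm cD s t by metis
  then show ?thesis using w that by blast
qed

lemma ring_localization: "fin_gset G X \<Longrightarrow> ring_localization (R X) (S X)"
  unfolding ring_localization_def ring_localization_axioms_def
  using cring_tambara S_sub S_one S_mult by auto

lemma fr_eq_iff:
  assumes "fin_gset G X" "x \<in> tval T X" "s \<in> S X" "y \<in> tval T X" "t \<in> S X"
  shows "fr X x s = fr X y t \<longleftrightarrow>
    (\<exists>u\<in>S X. u \<otimes>\<^bsub>R X\<^esub> (x \<otimes>\<^bsub>R X\<^esub> t) = u \<otimes>\<^bsub>R X\<^esub> (y \<otimes>\<^bsub>R X\<^esub> s))"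
  using ring_localization.frac_eq_iff[OF ring_localization[OF assms(1)]] assms
  by (simp add: tfrac_def)

lemma fr_scale:
  assumes "fin_gset G X" "x \<in> tval T X" "s \<in> S X" "a \<in> tval T X" "a \<otimes>\<^bsub>R X\<^esub> s \<in> S X"
  shows "fr X (a \<otimes>\<^bsub>R X\<^esub> x) (a \<otimes>\<^bsub>R X\<^esub> s) = fr X x s"
  using ring_localization.frac_scale[OF ring_localization[OF assms(1)]] assms
  by (simp add: tfrac_def)

lemma res_nrm_multiple:
  assumes f: "gmap G X Y f" and s: "s \<in> S X"
  obtains a where "a \<in> tval T X" "res T X Y f (nrm T X Y f s) = a \<otimes>\<^bsub>R X\<^esub> s"
proof -
  interpret cring "R X" using gmap_dom[OF f] by (rule cring_tambara)
  have sT: "s \<in> tval T X" using S_sub[OF gmap_dom[OF f] s] .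
  obtain C u v where uv: "gmap G C X u" "gmap G C X v"
    "res T X Y f (nrm T X Y f s) = s \<otimes>\<^bsub>R X\<^esub> nrm T C X u (res T C X v s)"
    using mul.upper_lower_self[OF f] sT by (metis ring_sel(1))
  then show ?thesis
    using that[of "nrm T C X u (res T C X v s)"] sT m_comm nrm_closed[OF uv(1)] res_closed[OF uv(2)]
    by simp
qed

lemma fr_expand:
  assumes f: "gmap G X Y f" and x: "x \<in> tval T X" and s: "s \<in> S X" and a: "a \<in> tval T X"
    and eq: "res T X Y f (nrm T X Y f s) = a \<otimes>\<^bsub>R X\<^esub> s"
  shows "fr X x s = fr X (a \<otimes>\<^bsub>R X\<^esub> x) (res T X Y f (nrm T X Y f s))"
  using fr_scale[OF gmap_dom[OF f] x s a] S_res[OF f S_nrm[OF f s]] eq by simp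

text \<open>The transfer uses only presentations whose denominator is restricted from \<open>Y\<close>, because for these
  the projection formula dictates \<open>f\<^sub>+(x / f\<^sup>*(t)) = f\<^sub>+(x) / t\<close>; the formula with an auxiliary factor \<open>a\<close>
  is the case \<open>x/s = ax / f\<^sup>*f\<^sub>\<bullet>(s)\<close>. Each union ranges over copies of a single class.\<close>

definition localized :: "('g, 'u, ('a \<times> 'a) set) tambara_data" where
  "localized = \<lparr>tval = (\<lambda>X. carrier (localization (R X) (S X))),
    res = (\<lambda>X Y f C. \<Union>(y, t)\<in>C. fr X (res T X Y f y) (res T X Y f t)),
    trf = (\<lambda>X Y f C. \<Union>{fr Y (trf T X Y f x) t | x t.
      x \<in> tval T X \<and> t \<in> S Y \<and> C = fr X x (res T X Y f t)}),
    nrm = (\<lambda>X Y f C. \<Union>(x, s)\<in>C. fr Y (nrm T X Y f x) (nrm T X Y f s))\<rparr>"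

abbreviation "L \<equiv> localized"

lemma fr_closed: "fin_gset G X \<Longrightarrow> x \<in> tval T X \<Longrightarrow> s \<in> S X \<Longrightarrow> fr X x s \<in> tval L X"
  using ring_localization.frac_carrier[OF ring_localization]
  by (simp add: localized_def tfrac_def)

lemma L_cases:
  assumes "fin_gset G X" "C \<in> tval L X"
  obtains x s where "x \<in> tval T X" "s \<in> S X" "C = fr X x s"
  using ring_localization.localization_cases[OF ring_localization[OF assms(1)], of C] assms(2)
  by (auto simp: localized_def tfrac_def)

text \<open>Since \<open>f\<^sup>*f\<^sub>\<bullet>(s)\<close> is a multiple of \<open>s\<close>, a fraction with denominator \<open>s\<close> can be
  expanded to one whose denominator is restricted from \<open>Y\<close>.\<close>

lemma L_cases_along:
  assumes f: "gmap G X Y f" and C: "C \<in> tval L X"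
  obtains x t where "x \<in> tval T X" "t \<in> S Y" "C = fr X x (res T X Y f t)"
proof -
  interpret cring "R X" using gmap_dom[OF f] by (rule cring_tambara)
  obtain x s where x: "x \<in> tval T X" and s: "s \<in> S X" and C: "C = fr X x s"
    using L_cases[OF gmap_dom[OF f] C] .
  obtain a where a: "a \<in> tval T X" "res T X Y f (nrm T X Y f s) = a \<otimes>\<^bsub>R X\<^esub> s"
    using res_nrm_multiple[OF f s] .
  show ?thesis
    using that[of "a \<otimes>\<^bsub>R X\<^esub> x" "nrm T X Y f s"] fr_expand[OF f x s a] C a x S_nrm[OF f s] m_closed
    by simp
qed

lemma res_fr:
  assumes f: "gmap G X Y f" and y: "y \<in> tval T Y" and t: "t \<in> S Y"
  shows "res L X Y f (fr Y y t) = fr X (res T X Y f y) (res T X Y f t)"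
proof -
  note X = gmap_dom[OF f] and Y = gmap_cod[OF f]
  have cong: "fr X (res T X Y f z) (res T X Y f w) = fr X (res T X Y f y) (res T X Y f t)"
    if z: "z \<in> tval T Y" "w \<in> S Y" and eq: "fr Y z w = fr Y y t" for z w
  proof -
    interpret cring "R Y" using Y by (rule cring_tambara)
    obtain u where u: "u \<in> S Y" "u \<otimes>\<^bsub>R Y\<^esub> (z \<otimes>\<^bsub>R Y\<^esub> t) = u \<otimes>\<^bsub>R Y\<^esub> (y \<otimes>\<^bsub>R Y\<^esub> w)"
      using eq fr_eq_iff[OF Y z y t] by blast
    note cl = y z(1) S_sub[OF Y t] S_sub[OF Y z(2)] S_sub[OF Y u(1)]
    have cl': "z \<otimes>\<^bsub>R Y\<^esub> t \<in> tval T Y" "y \<otimes>\<^bsub>R Y\<^esub> w \<in> tval T Y"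
      using cl m_closed[of z t] m_closed[of y w] by simp_all
    have "res T X Y f u \<otimes>\<^bsub>R X\<^esub> (res T X Y f z \<otimes>\<^bsub>R X\<^esub> res T X Y f t) = res T X Y f u \<otimes>\<^bsub>R X\<^esub> (res T X Y f y \<otimes>\<^bsub>R X\<^esub> res T X Y f w)"
      using arg_cong[OF u(2), of "res T X Y f"] cl cl' by (simp add: res_mult[OF f])
    then show ?thesis
      using fr_eq_iff[OF X res_closed[OF f z(1)] S_res[OF f z(2)] res_closed[OF f y] S_res[OF f t]]
        S_res[OF f u(1)] by blast
  qed
  have "(\<Union>(z, w)\<in>frac (R Y) (S Y) y t. fr X (res T X Y f z) (res T X Y f w)) =
      fr X (res T X Y f y) (res T X Y f t)"
  proof (rule ring_localization.frac_UN[OF ring_localization[OF Y], where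
        F = "\<lambda>z w. fr X (res T X Y f z) (res T X Y f w)"])
    show "y \<in> carrier (R Y)" "t \<in> S Y" using y t by simp_all
    fix z w assume "z \<in> carrier (R Y)" "w \<in> S Y"
      and "frac (R Y) (S Y) z w = frac (R Y) (S Y) y t"
    then show "fr X (res T X Y f z) (res T X Y f w) = fr X (res T X Y f y) (res T X Y f t)"
      by (intro cong) (simp_all only: carrier_ring tfrac_def)
  qed
  then show ?thesis by (simp add: localized_def tfrac_def)
qed

lemma nrm_fr:
  assumes f: "gmap G X Y f" and x: "x \<in> tval T X" and s: "s \<in> S X"
  shows "nrm L X Y f (fr X x s) = fr Y (nrm T X Y f x) (nrm T X Y f s)"
proof -
  note X = gmap_dom[OF f] and Y = gmap_cod[OF f]
  have cong: "fr Y (nrm T X Y f z) (nrm T X Y f w) = fr Y (nrm T X Y f x) (nrm T X Y f s)"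
    if z: "z \<in> tval T X" "w \<in> S X" and eq: "fr X z w = fr X x s" for z w
  proof -
    interpret cring "R X" using X by (rule cring_tambara)
    obtain u where u: "u \<in> S X" "u \<otimes>\<^bsub>R X\<^esub> (z \<otimes>\<^bsub>R X\<^esub> s) = u \<otimes>\<^bsub>R X\<^esub> (x \<otimes>\<^bsub>R X\<^esub> w)"
      using eq fr_eq_iff[OF X z x s] by blast
    note cl = x z(1) S_sub[OF X s] S_sub[OF X z(2)] S_sub[OF X u(1)]
    have cl': "z \<otimes>\<^bsub>R X\<^esub> s \<in> tval T X" "x \<otimes>\<^bsub>R X\<^esub> w \<in> tval T X"
      using cl m_closed[of z s] m_closed[of x w] by simp_all
    have "nrm T X Y f u \<otimes>\<^bsub>R Y\<^esub> (nrm T X Y f z \<otimes>\<^bsub>R Y\<^esub> nrm T X Y f s) = nrm T X Y f u \<otimes>\<^bsub>R Y\<^esub> (nrm T X Y f x \<otimes>\<^bsub>R Y\<^esub> nrm T X Y f w)"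
      using arg_cong[OF u(2), of "nrm T X Y f"] cl cl' by (simp add: nrm_mult[OF f])
    then show ?thesis
      using fr_eq_iff[OF Y nrm_closed[OF f z(1)] S_nrm[OF f z(2)] nrm_closed[OF f x] S_nrm[OF f s]]
        S_nrm[OF f u(1)] by blast
  qed
  have "(\<Union>(z, w)\<in>frac (R X) (S X) x s. fr Y (nrm T X Y f z) (nrm T X Y f w)) =
      fr Y (nrm T X Y f x) (nrm T X Y f s)"
  proof (rule ring_localization.frac_UN[OF ring_localization[OF X], where
        F = "\<lambda>z w. fr Y (nrm T X Y f z) (nrm T X Y f w)"])
    show "x \<in> carrier (R X)" "s \<in> S X" using x s by simp_all
    fix z w assume "z \<in> carrier (R X)" "w \<in> S X"
      and "frac (R X) (S X) z w = frac (R X) (S X) x s"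
    then show "fr Y (nrm T X Y f z) (nrm T X Y f w) = fr Y (nrm T X Y f x) (nrm T X Y f s)"
      by (intro cong) (simp_all only: carrier_ring tfrac_def)
  qed
  then show ?thesis by (simp add: localized_def tfrac_def)
qed

text \<open>If \<open>u\<close> witnesses the equality over \<open>X\<close>, then so does its multiple \<open>f\<^sup>*f\<^sub>\<bullet>(u)\<close>. That one is
  restricted from \<open>Y\<close>, so the transfer turns it into the witness \<open>f\<^sub>\<bullet>(u)\<close> over \<open>Y\<close>.\<close>

lemma trf_fr_cong:
  assumes f: "gmap G X Y f" and x: "x \<in> tval T X" "t \<in> S Y" and x': "x' \<in> tval T X" "t' \<in> S Y"
    and eq: "fr X x (res T X Y f t) = fr X x' (res T X Y f t')"
  shows "fr Y (trf T X Y f x) t = fr Y (trf T X Y f x') t'"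
proof -
  note X = gmap_dom[OF f] and Y = gmap_cod[OF f]
  interpret RX: cring "R X" using X by (rule cring_tambara)
  interpret RY: cring "R Y" using Y by (rule cring_tambara)
  note t = S_sub[OF Y x(2)] and t' = S_sub[OF Y x'(2)]
  obtain u where u: "u \<in> S X" "u \<otimes>\<^bsub>R X\<^esub> (x \<otimes>\<^bsub>R X\<^esub> res T X Y f t') = u \<otimes>\<^bsub>R X\<^esub> (x' \<otimes>\<^bsub>R X\<^esub> res T X Y f t)"
    using eq fr_eq_iff[OF X x(1) S_res[OF f x(2)] x'(1) S_res[OF f x'(2)]] by blast
  note uT = S_sub[OF X u(1)]
  let ?v = "nrm T X Y f u"
  have v: "?v \<in> S Y" "?v \<in> tval T Y" using S_nrm[OF f u(1)] nrm_closed[OF f uT] .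
  obtain a where a: "a \<in> tval T X" "res T X Y f ?v = a \<otimes>\<^bsub>R X\<^esub> u"
    using res_nrm_multiple[OF f u(1)] .
  have "trf T X Y f (res T X Y f (?v \<otimes>\<^bsub>R Y\<^esub> w) \<otimes>\<^bsub>R X\<^esub> z) =
      ?v \<otimes>\<^bsub>R Y\<^esub> (trf T X Y f z \<otimes>\<^bsub>R Y\<^esub> w)" if "z \<in> tval T X" "w \<in> tval T Y" for z w
    using projection[OF f _ that(1), of "?v \<otimes>\<^bsub>R Y\<^esub> w"] RY.m_closed[of ?v w] v that trf_closed[OF f that(1)]
    by (simp add: RY.m_ac mult_closed[OF Y])
  moreover have "res T X Y f (?v \<otimes>\<^bsub>R Y\<^esub> t') \<otimes>\<^bsub>R X\<^esub> x = res T X Y f (?v \<otimes>\<^bsub>R Y\<^esub> t) \<otimes>\<^bsub>R X\<^esub> x'"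
  proof -
    have rt: "res T X Y f t \<in> tval T X" "res T X Y f t' \<in> tval T X"
      using t t' res_closed[OF f] by auto
    have "res T X Y f (?v \<otimes>\<^bsub>R Y\<^esub> t') \<otimes>\<^bsub>R X\<^esub> x = a \<otimes>\<^bsub>R X\<^esub> (u \<otimes>\<^bsub>R X\<^esub> (x \<otimes>\<^bsub>R X\<^esub> res T X Y f t'))"
      using a uT x rt v t' by (simp add: res_mult[OF f] RX.m_ac mult_closed[OF X])
    also have "\<dots> = res T X Y f (?v \<otimes>\<^bsub>R Y\<^esub> t) \<otimes>\<^bsub>R X\<^esub> x'"
      unfolding u(2) using a uT x' rt v t by (simp add: res_mult[OF f] RX.m_ac mult_closed[OF X])
    finally show ?thesis .
  qed
  ultimately have "?v \<otimes>\<^bsub>R Y\<^esub> (trf T X Y f x \<otimes>\<^bsub>R Y\<^esub> t') = ?v \<otimes>\<^bsub>R Y\<^esub> (trf T X Y f x' \<otimes>\<^bsub>R Y\<^esub> t)"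
    using x x' t t' by metis
  then show ?thesis
    using v x x' trf_closed[OF f] by (subst fr_eq_iff[OF Y]) auto
qed

lemma trf_fr:
  assumes f: "gmap G X Y f" and x: "x \<in> tval T X" and t: "t \<in> S Y"
  shows "trf L X Y f (fr X x (res T X Y f t)) = fr Y (trf T X Y f x) t"
proof -
  have "{fr Y (trf T X Y f x') t' | x' t'.
      x' \<in> tval T X \<and> t' \<in> S Y \<and> fr X x (res T X Y f t) = fr X x' (res T X Y f t')} =
    {fr Y (trf T X Y f x) t}"
    using trf_fr_cong[OF f x t] x t by blast
  then show ?thesis by (simp add: localized_def)
qed

lemma res_L_closed:
  assumes f: "gmap G X Y f" and C: "C \<in> tval L Y"
  shows "res L X Y f C \<in> tval L X"
  using C by (rule L_cases[OF gmap_cod[OF f]])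
    (auto simp: res_fr[OF f] intro: fr_closed[OF gmap_dom[OF f] res_closed[OF f] S_res[OF f]])

lemma L_contravariant: "contravariant_functor G (tval L) (res L)"
  unfolding contravariant_functor_def
proof (intro conjI allI impI ballI)
  fix X Y :: "('g, 'u) gset" and f assume f: "gmap G X Y f"
  show "res L X Y f \<in> tval L Y \<rightarrow> tval L X" using res_L_closed[OF f] by blast
next
  fix X :: "('g, 'u) gset" and C assume X: "fin_gset G X" and C: "C \<in> tval L X"
  then show "res L X X (\<lambda>x\<in>pts X. x) C = C"
    by (elim L_cases[OF X]) (simp add: res_fr[OF gmap_id[OF X]] res_id[OF X] S_sub[OF X])
next
  fix X Y Z :: "('g, 'u) gset" and f h C assume "gmap G X Y f \<and> gmap G Y Z h" and C: "C \<in> tval L Z"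
  then have f: "gmap G X Y f" and h: "gmap G Y Z h" by auto
  note Z = gmap_cod[OF h]
  from C show "res L X Z (compose (pts X) h f) C = res L X Y f (res L Y Z h C)"
    by (elim L_cases[OF Z])
      (simp add: res_fr[OF gmap_compose[OF f h]] res_fr[OF f] res_fr[OF h] res_compose[OF f h]
        S_sub[OF Z] res_closed[OF h] S_res[OF h])
qed

lemma L_covariant_nrm: "covariant_functor G (tval L) (nrm L)"
  unfolding covariant_functor_def
proof (intro conjI allI impI ballI)
  fix X Y :: "('g, 'u) gset" and f assume f: "gmap G X Y f"
  note X = gmap_dom[OF f] and Y = gmap_cod[OF f]
  show "nrm L X Y f \<in> tval L X \<rightarrow> tval L Y"
  proof
    fix C assume "C \<in> tval L X"
    then show "nrm L X Y f C \<in> tval L Y"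
      using Y nrm_closed[OF f] S_nrm[OF f] by (elim L_cases[OF X]) (auto simp: nrm_fr[OF f] intro: fr_closed)
  qed
next
  fix X :: "('g, 'u) gset" and C assume X: "fin_gset G X" and C: "C \<in> tval L X"
  then show "nrm L X X (\<lambda>x\<in>pts X. x) C = C"
    by (elim L_cases[OF X]) (simp add: nrm_fr[OF gmap_id[OF X]] nrm_id[OF X] S_sub[OF X])
next
  fix X Y Z :: "('g, 'u) gset" and f h C assume "gmap G X Y f \<and> gmap G Y Z h" and C: "C \<in> tval L X"
  then have f: "gmap G X Y f" and h: "gmap G Y Z h" by auto
  note X = gmap_dom[OF f]
  from C show "nrm L X Z (compose (pts X) h f) C = nrm L Y Z h (nrm L X Y f C)"
    by (elim L_cases[OF X])
      (simp add: nrm_fr[OF gmap_compose[OF f h]] nrm_fr[OF f] nrm_fr[OF h] nrm_compose[OF f h]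
        S_sub[OF X] nrm_closed[OF f] S_nrm[OF f])
qed

lemma L_covariant_trf: "covariant_functor G (tval L) (trf L)"
  unfolding covariant_functor_def
proof (intro conjI allI impI ballI)
  fix X Y :: "('g, 'u) gset" and f assume f: "gmap G X Y f"
  note Y = gmap_cod[OF f]
  show "trf L X Y f \<in> tval L X \<rightarrow> tval L Y"
  proof
    fix C assume "C \<in> tval L X"
    then show "trf L X Y f C \<in> tval L Y"
      using Y trf_closed[OF f] by (elim L_cases_along[OF f]) (auto simp: trf_fr[OF f] intro: fr_closed)
  qed
next
  fix X :: "('g, 'u) gset" and C assume X: "fin_gset G X" and C: "C \<in> tval L X"
  obtain x s where x: "x \<in> tval T X" "s \<in> S X" "C = fr X x s" using L_cases[OF X C] .
  then show "trf L X X (\<lambda>x\<in>pts X. x) C = C"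
    using trf_fr[OF gmap_id[OF X] x(1,2)] trf_id[OF X x(1)] res_id[OF X S_sub[OF X x(2)]] by metis
next
  fix X Y Z :: "('g, 'u) gset" and f h C assume "gmap G X Y f \<and> gmap G Y Z h" and C: "C \<in> tval L X"
  then have f: "gmap G X Y f" and h: "gmap G Y Z h" by auto
  note hf = gmap_compose[OF f h]
  obtain x t where x: "x \<in> tval T X" and t: "t \<in> S Z"
    and C: "C = fr X x (res T X Z (compose (pts X) h f) t)"
    using L_cases_along[OF hf C] .
  have C': "C = fr X x (res T X Y f (res T Y Z h t))"
    using C res_compose[OF f h S_sub[OF gmap_cod[OF h] t]] by simp
  have "trf L X Z (compose (pts X) h f) C = fr Z (trf T Y Z h (trf T X Y f x)) t"
    using trf_fr[OF hf x t] trf_compose[OF f h x] C by simp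
  also have "\<dots> = trf L Y Z h (trf L X Y f C)"
    using trf_fr[OF f x S_res[OF h t]] trf_fr[OF h trf_closed[OF f x] t] C' by simp
  finally show "trf L X Z (compose (pts X) h f) C = trf L Y Z h (trf L X Y f C)" .
qed

text \<open>Numerators and denominators are glued separately; for injectivity, so are the witnesses of the two
  equalities of restricted fractions.\<close>

lemma L_coproduct:
  assumes c: "coproduct_diagram G X Y Z i j"
  shows "bij_betw (\<lambda>C. (res L X Z i C, res L Y Z j C)) (tval L Z) (tval L X \<times> tval L Y)"
proof -
  note cD = coproductD[OF c]
  note X = cD(7) and Y = cD(8) and Z = cD(9) and i = cD(1) and j = cD(2)
  interpret RZ: cring "R Z" using Z by (rule cring_tambara)
  have "C = C'" if C: "C \<in> tval L Z" "C' \<in> tval L Z"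
    and eq: "res L X Z i C = res L X Z i C'" "res L Y Z j C = res L Y Z j C'" for C C'
  proof -
    obtain z w where z: "z \<in> tval T Z" "w \<in> S Z" "C = fr Z z w" using L_cases[OF Z C(1)] .
    obtain z' w' where z': "z' \<in> tval T Z" "w' \<in> S Z" "C' = fr Z z' w'" using L_cases[OF Z C(2)] .
    note w = S_sub[OF Z z(2)] S_sub[OF Z z'(2)]
    have "fr X (res T X Z i z) (res T X Z i w) = fr X (res T X Z i z') (res T X Z i w')"
      using eq(1) z z' by (simp add: res_fr[OF i])
    then obtain u where u: "u \<in> S X" "u \<otimes>\<^bsub>R X\<^esub> res T X Z i (z \<otimes>\<^bsub>R Z\<^esub> w') = u \<otimes>\<^bsub>R X\<^esub> res T X Z i (z' \<otimes>\<^bsub>R Z\<^esub> w)"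
      using z z' w by (auto simp: fr_eq_iff[OF X] res_closed[OF i] S_res[OF i] res_mult[OF i])
    have "fr Y (res T Y Z j z) (res T Y Z j w) = fr Y (res T Y Z j z') (res T Y Z j w')"
      using eq(2) z z' by (simp add: res_fr[OF j])
    then obtain v where v: "v \<in> S Y" "v \<otimes>\<^bsub>R Y\<^esub> res T Y Z j (z \<otimes>\<^bsub>R Z\<^esub> w') = v \<otimes>\<^bsub>R Y\<^esub> res T Y Z j (z' \<otimes>\<^bsub>R Z\<^esub> w)"
      using z z' w by (auto simp: fr_eq_iff[OF Y] res_closed[OF j] S_res[OF j] res_mult[OF j])
    obtain q where q: "q \<in> S Z" "res T X Z i q = u" "res T Y Z j q = v" using S_glue[OF c u(1) v(1)] .
    note qT = S_sub[OF Z q(1)]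
    have cl: "z \<otimes>\<^bsub>R Z\<^esub> w' \<in> tval T Z" "z' \<otimes>\<^bsub>R Z\<^esub> w \<in> tval T Z"
      using RZ.m_closed[of z w'] RZ.m_closed[of z' w] z z' w by simp_all
    then have cl': "q \<otimes>\<^bsub>R Z\<^esub> (z \<otimes>\<^bsub>R Z\<^esub> w') \<in> tval T Z" "q \<otimes>\<^bsub>R Z\<^esub> (z' \<otimes>\<^bsub>R Z\<^esub> w) \<in> tval T Z"
      using RZ.m_closed[of q] qT by simp_all
    have "q \<otimes>\<^bsub>R Z\<^esub> (z \<otimes>\<^bsub>R Z\<^esub> w') = q \<otimes>\<^bsub>R Z\<^esub> (z' \<otimes>\<^bsub>R Z\<^esub> w)"
      by (rule add.coproduct_eqI[OF c cl'])
        (simp_all add: res_mult[OF i qT] res_mult[OF j qT] cl q u v)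
    then show ?thesis using z z' q(1) by (auto simp: fr_eq_iff[OF Z])
  qed
  moreover have "\<exists>C\<in>tval L Z. res L X Z i C = A \<and> res L Y Z j C = B"
    if A: "A \<in> tval L X" and B: "B \<in> tval L Y" for A B
  proof -
    obtain x s where x: "x \<in> tval T X" "s \<in> S X" "A = fr X x s" using L_cases[OF X A] .
    obtain y t where y: "y \<in> tval T Y" "t \<in> S Y" "B = fr Y y t" using L_cases[OF Y B] .
    obtain z where z: "z \<in> tval T Z" "res T X Z i z = x" "res T Y Z j z = y"
      using add.glue_exists[OF c x(1) y(1)] .
    obtain w where w: "w \<in> S Z" "res T X Z i w = s" "res T Y Z j w = t"
      using S_glue[OF c x(2) y(2)] .
    show ?thesis
      using x y z w by (intro bexI[of _ "fr Z z w"]) (auto simp: res_fr[OF i] res_fr[OF j] intro: fr_closed[OF Z])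
  qed
  moreover have "res L X Z i C \<in> tval L X" "res L Y Z j C \<in> tval L Y" if "C \<in> tval L Z" for C
    using that by (rule res_L_closed[OF i] res_L_closed[OF j])+
  ultimately show ?thesis unfolding bij_betw_def inj_on_def by (fastforce simp: image_iff)
qed

lemma L_pullback_nrm:
  assumes P: "pullback_square G X Y X' Y' f h k l" and C: "C \<in> tval L Y'"
  shows "res L X Y f (nrm L Y' Y h C) = nrm L X' X k (res L X' Y' l C)"
proof -
  note f = pullbackD(1)[OF P] and h = pullbackD(2)[OF P] and k = pullbackD(3)[OF P]
    and l = pullbackD(4)[OF P]
  note Y' = gmap_dom[OF h]
  from C show ?thesis
    by (elim L_cases[OF Y'])
      (simp add: res_fr[OF f] res_fr[OF l] nrm_fr[OF h] nrm_fr[OF k] nrm_closed[OF h] S_nrm[OF h]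
        res_closed[OF l] S_res[OF l] mul.upper_lower[OF P] S_sub[OF Y'])
qed

lemma L_pullback_trf:
  assumes P: "pullback_square G X Y X' Y' f h k l" and C: "C \<in> tval L Y'"
  shows "res L X Y f (trf L Y' Y h C) = trf L X' X k (res L X' Y' l C)"
proof -
  note f = pullbackD(1)[OF P] and h = pullbackD(2)[OF P] and k = pullbackD(3)[OF P]
    and l = pullbackD(4)[OF P]
  obtain c t where c: "c \<in> tval T Y'" and t: "t \<in> S Y" and C: "C = fr Y' c (res T Y' Y h t)"
    using L_cases_along[OF h C] .
  note tT = S_sub[OF gmap_cod[OF h] t]
  have "compose (pts X') h l = compose (pts X') f k"
    using pullbackD(5)[OF P] by (auto simp: compose_def)
  then have lh: "res T X' Y' l (res T Y' Y h t) = res T X' X k (res T X Y f t)"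
    using res_compose[OF l h tT] res_compose[OF k f tT] by simp
  have "res L X Y f (trf L Y' Y h C) = fr X (trf T X' X k (res T X' Y' l c)) (res T X Y f t)"
    using C c t by (simp add: trf_fr[OF h] res_fr[OF f] trf_closed[OF h] add.upper_lower[OF P])
  also have "\<dots> = trf L X' X k (res L X' Y' l C)"
    using C c t S_res[OF h t] S_res[OF f t] res_closed[OF l c]
    by (simp add: res_fr[OF l] lh trf_fr[OF k])
  finally show ?thesis .
qed

text \<open>Writing the fraction as \<open>a / p\<^sup>*(t)\<close>, both sides have the denominator \<open>f\<^sub>\<bullet>(t)\<close>, and the numerators
  agree by the distributive law of \<open>T\<close>.\<close>

lemma L_exponential:
  assumes E: "exponential_diagram G X Y A Z B f p l r q" and C: "C \<in> tval L A"
  shows "nrm L X Y f (trf L A X p C) = trf L B Y q (nrm L Z B r (res L Z A l C))"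
proof -
  have f: "gmap G X Y f" and p: "gmap G A X p" and l: "gmap G Z A l" and r: "gmap G Z B r"
    and q: "gmap G B Y q" using E by (auto simp: exponential_diagram_def)
  obtain a t where a: "a \<in> tval T A" and t: "t \<in> S X" and C: "C = fr A a (res T A X p t)"
    using L_cases_along[OF p C] .
  note tT = S_sub[OF gmap_cod[OF p] t]
  (* the outer rectangle is cartesian, so the norm of the denominator along r is restricted from Y *)
  have den: "nrm T Z B r (res T Z A l (res T A X p t)) = res T B Y q (nrm T X Y f t)"
  proof -
    have "pullback_square G B Y Z X q f r (compose (pts Z) p l)"
      using exponential_pullback[OF E] by (rule pullback_swap)
    then show ?thesis
      using mul.upper_lower[of B Y Z X q f r "compose (pts Z) p l" t] tT res_compose[OF l p tT] by simp
  qed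
  have "nrm L X Y f (trf L A X p C) = fr Y (trf T B Y q (nrm T Z B r (res T Z A l a))) (nrm T X Y f t)"
    using C a t by (simp add: trf_fr[OF p] nrm_fr[OF f] trf_closed[OF p] exponential[OF E])
  also have "\<dots> = trf L B Y q (nrm L Z B r (res L Z A l C))"
    using C a t S_res[OF p t] S_res[OF l S_res[OF p t]] res_closed[OF l a] S_nrm[OF f t]
      nrm_closed[OF r res_closed[OF l a]]
    by (simp add: res_fr[OF l] nrm_fr[OF r] den trf_fr[OF q])
  finally show ?thesis .
qed

lemma L_nonempty: "fin_gset G X \<Longrightarrow> tval L X \<noteq> {}"
  using fr_closed S_one S_sub by blast

sublocale L_add: semi_mackey G "add_part L"
  rewrites "val (add_part L) = tval L" and "upper (add_part L) = res L"
    and "lower (add_part L) = trf L"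
proof -
  have "semi_mackey_functor G (add_part L)"
    unfolding semi_mackey_functor_def
    using L_contravariant L_covariant_trf L_coproduct L_pullback_trf by (simp add: add_part_def)
  then show "semi_mackey G (add_part L)"
    using infinite_points L_nonempty by unfold_locales (simp_all add: add_part_def)
qed (simp_all add: add_part_def)

sublocale L_mul: semi_mackey G "mult_part L"
  rewrites "val (mult_part L) = tval L" and "upper (mult_part L) = res L"
    and "lower (mult_part L) = nrm L"
proof -
  have "semi_mackey_functor G (mult_part L)"
    unfolding semi_mackey_functor_def
    using L_contravariant L_covariant_nrm L_coproduct L_pullback_nrm by (simp add: mult_part_def)
  then show "semi_mackey G (mult_part L)"
    using infinite_points L_nonempty by unfold_locales (simp_all add: mult_part_def)
qed (simp_all add: mult_part_def)

subsection \<open>Its ring structure\<close>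

text \<open>The two summands are first brought to the common denominator \<open>st\<close>. An element over \<open>X \<amalg> X\<close> with
  these components can then be given the denominator \<open>d\<^sup>*(st)\<close>, on which the transfer along the folding
  map \<open>d\<close> is known.\<close>

lemma L_add_fr:
  assumes X: "fin_gset G X" and x: "x \<in> tval T X" "s \<in> S X" and y: "y \<in> tval T X" "t \<in> S X"
  shows "mackey_op G (add_part L) X (fr X x s) (fr X y t) =
    fr X (x \<otimes>\<^bsub>R X\<^esub> t \<oplus>\<^bsub>R X\<^esub> y \<otimes>\<^bsub>R X\<^esub> s) (s \<otimes>\<^bsub>R X\<^esub> t)"
proof -
  interpret cring "R X" using X by (rule cring_tambara)
  obtain W i j d where W: "coproduct_diagram G X X W i j" and d: "gmap G W X d"
    "\<And>x. x \<in> pts X \<Longrightarrow> d (i x) = x" "\<And>x. x \<in> pts X \<Longrightarrow> d (j x) = x"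
    using add.fold_exists[OF X] by blast
  note i = coproductD(1)[OF W] and j = coproductD(2)[OF W] and fW = coproductD(9)[OF W]
  note st = S_sub[OF X x(2)] S_sub[OF X y(2)] S_mult[OF X x(2) y(2)]
  let ?st = "s \<otimes>\<^bsub>R X\<^esub> t"
  have cl: "x \<otimes>\<^bsub>R X\<^esub> t \<in> tval T X" "y \<otimes>\<^bsub>R X\<^esub> s \<in> tval T X"
    using m_closed[of x t] m_closed[of y s] x y st by simp_all
  obtain z where z: "z \<in> tval T W" "res T X W i z = x \<otimes>\<^bsub>R X\<^esub> t" "res T X W j z = y \<otimes>\<^bsub>R X\<^esub> s"
    using add.glue_exists[OF W cl] .
  let ?C = "fr W z (res T W X d ?st)"
  have C: "?C \<in> tval L W" using fr_closed[OF fW z(1) S_res[OF d(1) st(3)]] .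
  have "res L X W i ?C = fr X (t \<otimes>\<^bsub>R X\<^esub> x) (t \<otimes>\<^bsub>R X\<^esub> s)"
    using fold_retract[OF W d S_sub[OF X st(3)]] z x y st
    by (simp add: res_fr[OF i] S_res[OF d(1)] m_comm)
  then have "res L X W i ?C = fr X x s"
    using fr_scale[OF X x st(2)] S_mult[OF X y(2) x(2)] by simp
  moreover have "res L X W j ?C = fr X (s \<otimes>\<^bsub>R X\<^esub> y) (s \<otimes>\<^bsub>R X\<^esub> t)"
    using fold_retract[OF W d S_sub[OF X st(3)]] z x y st
    by (simp add: res_fr[OF j] S_res[OF d(1)] m_comm)
  then have "res L X W j ?C = fr X y t"
    using fr_scale[OF X y st(1)] S_mult[OF X x(2) y(2)] by simp
  moreover have "trf L W X d ?C = fr X (x \<otimes>\<^bsub>R X\<^esub> t \<oplus>\<^bsub>R X\<^esub> y \<otimes>\<^bsub>R X\<^esub> s) ?st"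
    using trf_fr[OF d(1) z(1) st(3)] add.mackey_op_eq[OF W d z(1)] z by (simp add: ring_sel)
  ultimately show ?thesis using L_add.mackey_op_eq[OF W d C] by simp
qed

lemma L_mult_fr:
  assumes X: "fin_gset G X" and x: "x \<in> tval T X" "s \<in> S X" and y: "y \<in> tval T X" "t \<in> S X"
  shows "mackey_op G (mult_part L) X (fr X x s) (fr X y t) = fr X (x \<otimes>\<^bsub>R X\<^esub> y) (s \<otimes>\<^bsub>R X\<^esub> t)"
proof -
  obtain W i j d where W: "coproduct_diagram G X X W i j" and d: "gmap G W X d"
    "\<And>x. x \<in> pts X \<Longrightarrow> d (i x) = x" "\<And>x. x \<in> pts X \<Longrightarrow> d (j x) = x"
    using add.fold_exists[OF X] by blast
  note i = coproductD(1)[OF W] and j = coproductD(2)[OF W] and fW = coproductD(9)[OF W]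
  obtain z where z: "z \<in> tval T W" "res T X W i z = x" "res T X W j z = y"
    using add.glue_exists[OF W x(1) y(1)] .
  obtain w where w: "w \<in> S W" "res T X W i w = s" "res T X W j w = t"
    using S_glue[OF W x(2) y(2)] .
  note C = fr_closed[OF fW z(1) w(1)]
  have "nrm L W X d (fr W z w) = fr X (x \<otimes>\<^bsub>R X\<^esub> y) (s \<otimes>\<^bsub>R X\<^esub> t)"
    using nrm_fr[OF d(1) z(1) w(1)] mul.mackey_op_eq[OF W d z(1)]
      mul.mackey_op_eq[OF W d S_sub[OF fW w(1)]] z w by (simp add: ring_sel)
  then show ?thesis
    using L_mul.mackey_op_eq[OF W d C] z w by (simp add: res_fr[OF i] res_fr[OF j])
qed

lemma
  assumes X: "fin_gset G X"
  shows L_zero: "mackey_unit G (add_part L) X = fr X \<zero>\<^bsub>R X\<^esub> \<one>\<^bsub>R X\<^esub>"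
    and L_one: "mackey_unit G (mult_part L) X = fr X \<one>\<^bsub>R X\<^esub> \<one>\<^bsub>R X\<^esub>"
proof -
  obtain E :: "('g, 'u) gset" where E: "fin_gset G E" "pts E = {}" using empty_gset_exists .
  interpret cring "R E" using E(1) by (rule cring_tambara)
  have u: "gmap G E X (\<lambda>x. undefined)" using gmap_from_empty[OF E(1) X E(2)] .
  have z: "\<zero>\<^bsub>R E\<^esub> \<in> tval T E" "\<one>\<^bsub>R E\<^esub> \<in> tval T E" using zero_closed one_closed by simp_all
  show "mackey_unit G (add_part L) X = fr X \<zero>\<^bsub>R X\<^esub> \<one>\<^bsub>R X\<^esub>"
    using L_add.mackey_unit_eq[OF E u fr_closed[OF E(1) z(1) S_one[OF E(1)]]]
      trf_fr[OF u z(1) S_one[OF X]] by (simp add: res_one[OF u] trf_zero[OF u])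
  show "mackey_unit G (mult_part L) X = fr X \<one>\<^bsub>R X\<^esub> \<one>\<^bsub>R X\<^esub>"
    using L_mul.mackey_unit_eq[OF E u fr_closed[OF E(1) z(2) S_one[OF E(1)]]]
      nrm_fr[OF u z(2) S_one[OF E(1)]] by (simp add: nrm_one[OF u])
qed

lemma L_add_comm_group:
  assumes X: "fin_gset G X"
  shows "comm_group (mackey_monoid G (add_part L) X)"
proof -
  interpret RX: cring "R X" using X by (rule cring_tambara)
  let ?M = "mackey_monoid G (add_part L) X"
  interpret M: comm_monoid ?M using X by (rule L_add.mackey_comm_monoid)
  have inv: "\<exists>B\<in>carrier ?M. B \<otimes>\<^bsub>?M\<^esub> A = \<one>\<^bsub>?M\<^esub>" if "A \<in> carrier ?M" for A
  proof -
    have "A \<in> tval L X" using that by (simp add: mackey_monoid_def add_part_def)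
    then obtain x s where x: "x \<in> tval T X" "s \<in> S X" and A: "A = fr X x s" by (rule L_cases[OF X])
    let ?x = "\<ominus>\<^bsub>R X\<^esub> x"
    note s = S_sub[OF X x(2)]
    have x': "?x \<in> tval T X" using RX.a_inv_closed[of x] x by simp
    have "?x \<otimes>\<^bsub>R X\<^esub> s \<oplus>\<^bsub>R X\<^esub> x \<otimes>\<^bsub>R X\<^esub> s = \<zero>\<^bsub>R X\<^esub>"
      using x s x' RX.l_distr[of ?x x s, symmetric] by (simp add: RX.l_neg)
    then have "mackey_op G (add_part L) X (fr X ?x s) A = fr X \<zero>\<^bsub>R X\<^esub> (s \<otimes>\<^bsub>R X\<^esub> s)"
      using L_add_fr[OF X x' x(2) x] A by simp
    also have "\<dots> = fr X \<zero>\<^bsub>R X\<^esub> \<one>\<^bsub>R X\<^esub>"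
      using S_mult[OF X x(2) x(2)] S_one[OF X] S_sub[OF X] RX.zero_closed
      by (subst fr_eq_iff[OF X]) auto
    finally show ?thesis
      using fr_closed[OF X x' x(2)] by (auto simp: mackey_monoid_def add_part_def L_zero[OF X, unfolded add_part_def])
  qed
  show ?thesis
    by (rule comm_groupI) (simp_all only: M.m_closed M.one_closed M.m_assoc M.l_one inv, rule M.m_comm)
qed

lemma tambara_functor_L: "tambara_functor G L"
  unfolding tambara_functor_def mackey_functor_def
  using L_add.semi_mackey L_mul.semi_mackey L_add_comm_group L_exponential by blast

lemma L_ring_iso:
  assumes X: "fin_gset G X"
  shows "id \<in> ring_iso (localization (R X) (S X)) (tambara_ring G L X)"
proof -
  let ?Q = "localization (R X) (S X)"
  interpret ring_localization "R X" "S X" using X by (rule ring_localization)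
  have car: "carrier ?Q = tval L X" by (simp add: localized_def)
  have "id \<in> ring_hom ?Q (tambara_ring G L X)"
  proof (rule ring_hom_memI)
    fix A B assume "A \<in> carrier ?Q" "B \<in> carrier ?Q"
    then obtain x s y t where A: "x \<in> tval T X" "s \<in> S X" "A = fr X x s"
      and B: "y \<in> tval T X" "t \<in> S X" "B = fr X y t"
      unfolding car by (auto elim!: L_cases[OF X])
    show "id (A \<otimes>\<^bsub>?Q\<^esub> B) = id A \<otimes>\<^bsub>tambara_ring G L X\<^esub> id B"
      using A B L_mult_fr[OF X A(1,2) B(1,2)] mult_frac[of x s y t]
      by (simp add: tambara_ring_def[of G L] tfrac_def)
    show "id (A \<oplus>\<^bsub>?Q\<^esub> B) = id A \<oplus>\<^bsub>tambara_ring G L X\<^esub> id B"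
      using A B L_add_fr[OF X A(1,2) B(1,2)] add_frac[of x s y t]
      by (simp add: tambara_ring_def[of G L] tfrac_def)
  next
    show "id \<one>\<^bsub>?Q\<^esub> = \<one>\<^bsub>tambara_ring G L X\<^esub>"
      using L_one[OF X] by (simp add: tambara_ring_def[of G L] tfrac_def localization_def)
  qed (simp add: tambara_ring_def[of G L] car)
  then show ?thesis
    by (simp add: ring_iso_def car tambara_ring_def[of G L])
qed

lemma induced_structure_L: "induced_structure G T S L"
  unfolding induced_structure_def
proof (intro conjI allI impI ballI)
  fix X :: "('g, 'u) gset" assume "fin_gset G X"
  then show "id \<in> ring_iso (localization (R X) (S X)) (tambara_ring G L X)" by (rule L_ring_iso)
next
  fix X Y :: "('g, 'u) gset" and f s assume f: "gmap G X Y f" and s: "s \<in> S X"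
  show "\<exists>a\<in>tval T X. res T X Y f (nrm T X Y f s) = a \<otimes>\<^bsub>R X\<^esub> s"
    using res_nrm_multiple[OF f s] by blast
next
  fix X Y :: "('g, 'u) gset" and f x s a assume f: "gmap G X Y f" and x: "x \<in> tval T X" and s: "s \<in> S X"
    and a: "a \<in> tval T X" "res T X Y f (nrm T X Y f s) = a \<otimes>\<^bsub>R X\<^esub> s"
  interpret cring "R X" using gmap_dom[OF f] by (rule cring_tambara)
  have "a \<otimes>\<^bsub>R X\<^esub> x \<in> tval T X" using m_closed[of a x] a x by simp
  then show "trf L X Y f (fr X x s) = fr Y (trf T X Y f (a \<otimes>\<^bsub>R X\<^esub> x)) (nrm T X Y f s)"
    using trf_fr[OF f _ S_nrm[OF f s]] fr_expand[OF f x s a] by simp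
qed (simp_all add: localized_def[THEN arg_cong, of tval] res_fr nrm_fr)

lemma tambara_morphism_L: "tambara_morphism G T L (\<lambda>X x. fr X x \<one>\<^bsub>R X\<^esub>)"
  unfolding tambara_morphism_def
proof (intro conjI allI impI ballI)
  fix X :: "('g, 'u) gset" assume X: "fin_gset G X"
  interpret cring "R X" using X by (rule cring_tambara)
  have one: "\<one>\<^bsub>R X\<^esub> \<in> tval T X" using one_closed by simp
  then have one_one: "\<one>\<^bsub>R X\<^esub> \<otimes>\<^bsub>R X\<^esub> \<one>\<^bsub>R X\<^esub> = \<one>\<^bsub>R X\<^esub>" by simp
  show "(\<lambda>x. fr X x \<one>\<^bsub>R X\<^esub>) \<in> ring_hom (R X) (tambara_ring G L X)"
  proof (rule ring_hom_memI)
    fix x y assume x: "x \<in> carrier (R X)" and y: "y \<in> carrier (R X)"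
    show "fr X (x \<otimes>\<^bsub>R X\<^esub> y) \<one>\<^bsub>R X\<^esub> = fr X x \<one>\<^bsub>R X\<^esub> \<otimes>\<^bsub>tambara_ring G L X\<^esub> fr X y \<one>\<^bsub>R X\<^esub>"
      using L_mult_fr[OF X _ S_one[OF X] _ S_one[OF X], of x y] x y
      by (simp add: tambara_ring_def[of G L] one_one)
    show "fr X (x \<oplus>\<^bsub>R X\<^esub> y) \<one>\<^bsub>R X\<^esub> = fr X x \<one>\<^bsub>R X\<^esub> \<oplus>\<^bsub>tambara_ring G L X\<^esub> fr X y \<one>\<^bsub>R X\<^esub>"
      using L_add_fr[OF X _ S_one[OF X] _ S_one[OF X], of x y] x y
      by (simp add: tambara_ring_def[of G L] one_one)
  qed (simp_all add: tambara_ring_def[of G L] L_one[OF X] fr_closed[OF X _ S_one[OF X]])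
next
  fix X Y :: "('g, 'u) gset" and f assume f: "gmap G X Y f"
  note X = gmap_dom[OF f] and Y = gmap_cod[OF f]
  show "fr X (res T X Y f y) \<one>\<^bsub>R X\<^esub> = res L X Y f (fr Y y \<one>\<^bsub>R Y\<^esub>)" if "y \<in> tval T Y" for y
    using res_fr[OF f that S_one[OF Y]] by (simp add: res_one[OF f])
  show "fr Y (trf T X Y f x) \<one>\<^bsub>R Y\<^esub> = trf L X Y f (fr X x \<one>\<^bsub>R X\<^esub>)" if "x \<in> tval T X" for x
    using trf_fr[OF f that S_one[OF Y]] by (simp add: res_one[OF f])
  show "fr Y (nrm T X Y f x) \<one>\<^bsub>R Y\<^esub> = nrm L X Y f (fr X x \<one>\<^bsub>R X\<^esub>)" if "x \<in> tval T X" for x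
    using nrm_fr[OF f that S_one[OF X]] by (simp add: nrm_one[OF f])
qed

end

theorem proposition4p3:
  fixes G :: "('g, 'm) monoid_scheme"
    and T :: "('g, 'u, 'a) tambara_data"
    and S :: "('g, 'u) gset \<Rightarrow> 'a set"
  assumes "group G" and "finite (carrier G)" and "infinite (UNIV :: 'u set)"
    and "tambara_functor G T"
    and "semi_mackey_subfunctor G (mult_part T) S"
  shows "\<exists>L :: ('g, 'u, ('a \<times> 'a) set) tambara_data.
    induced_structure G T S L \<and>
    tambara_functor G L \<and>
    tambara_morphism G T L (\<lambda>X x. tfrac G T S X x \<one>\<^bsub>tambara_ring G T X\<^esub>)"
proof -
  interpret tambara_localization G T S
    using assms
    by (simp add: tambara_localization_def tambara_def tambara_axioms_def tambara_localization_axioms_def)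
  show ?thesis using induced_structure_L tambara_functor_L tambara_morphism_L by blast
qed

end
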